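(* Let $(\Omega,\mathcal A,\mu)$ be a $\sigma$-finite measure space with $\mu(\Omega)=\infty$ which is quasi-non-atomic. Given a fully symmetric space $E\subset\mathcal L^1(\Omega)+\mathcal L^\infty(\Omega)$, the following conditions are equivalent: (1) $E\in IET(\Omega)$; (2) $E\subset\mathcal R_\mu$; (3) $\mathbf 1\notin E$.
   Context: $(\Omega,\mathcal A,\mu)$ is a complete measure space. $\mathcal L^0=\mathcal L^0(\Omega)$ is the algebra of equivalence classes of a.e. finite real-valued measurable functions on $\Omega$, and $\mathcal L^p=\mathcal L^p(\Omega)\subset\mathcal L^0$ ($1\le p\le\infty$) is the real $L^p$-space with its standard norm $\|\cdot\|_p$; $\mathcal L^1+\mathcal L^\infty=\{g+h: g\in\mathcal L^1,\ h\in\mathcal L^\infty\}$. $\mathbf 1=\chi_\Omega$ is the characteristic function of $\Omega$. The measure space $(\Omega,\mu)$ is called quasi-non-atomic if it has finitely many atoms (possibly none) or all its atoms have the same measure. For $f\in\mathcal L^1+\mathcal L^\infty$ the non-increasing rearrangement is $\mu_t(f)=\inf\{\lambda>0:\ \mu\{|f|>\lambda\}\le t\}$, $t>0$, and $\mathcal R_\mu=\{f\in\mathcal L^1+\mathcal L^\infty:\ \mu_t(f)\to 0 \text{ as } t\to\infty\}$. A Banach space $(E,\|\cdot\|_E)$ with $E$ a linear subspace of $\mathcal L^1+\mathcal L^\infty$ is called fully symmetric if, whenever $f\in E$, $g\in\mathcal L^1+\mathcal L^\infty$ and $\int_0^s\mu_t(g)\,dt\le\int_0^s\mu_t(f)\,dt$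 for all $s>0$, it follows that $g\in E$ and $\|g\|_E\le\|f\|_E$. A linear operator $T:\mathcal L^1+\mathcal L^\infty\to\mathcal L^1+\mathcal L^\infty$ is a Dunford-Schwartz operator (written $T\in DS$) if $\|T(f)\|_1\le\|f\|_1$ for all $f\in\mathcal L^1$ and $\|T(f)\|_\infty\le\|f\|_\infty$ for all $f\in\mathcal L^\infty$. Its ergodic averages are $A_n(T,f)=\frac1n\sum_{k=0}^{n-1}T^k(f)$. A fully symmetric space $E\subset\mathcal L^1(\Omega)+\mathcal L^\infty(\Omega)$ possesses the individual ergodic theorem property, written $E\in IET(\Omega)$, if for every $f\in E$ and every $T\in DS$ the averages $A_n(T,f)$ converge a.e. to some $\widehat f\in E$. *)

theory Defs
  imports "HOL-Probability.Essential_Supremum"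
begin

text \<open>
  Equivalence classes of measurable functions are represented by their members: a space of
  classes is a set of functions closed under equality almost everywhere, and equality in such
  a space is equality almost everywhere.
\<close>

definition L1 :: "'a measure \<Rightarrow> ('a \<Rightarrow> real) set" where
  "L1 M = {f. integrable M f}"

definition norm1 :: "'a measure \<Rightarrow> ('a \<Rightarrow> real) \<Rightarrow> ennreal" where
  "norm1 M f = (\<integral>\<^sup>+ x. ennreal \<bar>f x\<bar> \<partial>M)"

definition norm_inf :: "'a measure \<Rightarrow> ('a \<Rightarrow> real) \<Rightarrow> ennreal" where
  "norm_inf M f = esssup M (\<lambda>x. ennreal \<bar>f x\<bar>)"

definition Linf :: "'a measure \<Rightarrow> ('a \<Rightarrow> real) set" where
  "Linf M = {f \<in> borel_measurable M. norm_inf M f < \<infinity>}"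

definition L1_plus_Linf :: "'a measure \<Rightarrow> ('a \<Rightarrow> real) set" where
  "L1_plus_Linf M =
     {f \<in> borel_measurable M. \<exists>g \<in> L1 M. \<exists>h \<in> Linf M. AE x in M. f x = g x + h x}"


definition atoms :: "'a measure \<Rightarrow> 'a set set" where
  "atoms M = {A \<in> sets M. emeasure M A > 0 \<and>
     (\<forall>B \<in> sets M. B \<subseteq> A \<longrightarrow> emeasure M B = 0 \<or> emeasure M B = emeasure M A)}"

text \<open>Atoms are counted modulo null sets.\<close>

definition atom_equiv :: "'a measure \<Rightarrow> ('a set \<times> 'a set) set" where
  "atom_equiv M = {(A, B) \<in> atoms M \<times> atoms M. emeasure M (sym_diff A B) = 0}"

definition quasi_non_atomic :: "'a measure \<Rightarrow> bool" where
  "quasi_non_atomic M \<longleftrightarrow>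
     finite (atoms M // atom_equiv M) \<or>
     (\<forall>A \<in> atoms M. \<forall>B \<in> atoms M. emeasure M A = emeasure M B)"


text \<open>
  For \<open>f\<close> in \<^term>\<open>L1_plus_Linf M\<close> and \<open>t > 0\<close> the set below is nonempty, so
  the real infimum is the intended one.
\<close>

definition rearrangement :: "'a measure \<Rightarrow> ('a \<Rightarrow> real) \<Rightarrow> real \<Rightarrow> real" where
  "rearrangement M f t =
     Inf {l. l > 0 \<and> emeasure M {x \<in> space M. \<bar>f x\<bar> > l} \<le> ennreal t}"

definition R_space :: "'a measure \<Rightarrow> ('a \<Rightarrow> real) set" where
  "R_space M = {f \<in> L1_plus_Linf M. (rearrangement M f \<longlongrightarrow> 0) at_top}"

definition submajorized :: "'a measure \<Rightarrow> ('a \<Rightarrow> real) \<Rightarrow> ('a \<Rightarrow> real) \<Rightarrow> bool" where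
  "submajorized M g f \<longleftrightarrow>
     (\<forall>s>0. (\<integral>\<^sup>+ t\<in>{0<..s}. ennreal (rearrangement M g t) \<partial>lborel)
           \<le> (\<integral>\<^sup>+ t\<in>{0<..s}. ennreal (rearrangement M f t) \<partial>lborel))"


definition ae_subspace :: "'a measure \<Rightarrow> ('a \<Rightarrow> real) set \<Rightarrow> bool" where
  "ae_subspace M E \<longleftrightarrow>
     E \<subseteq> L1_plus_Linf M \<and>
     (\<forall>f \<in> E. \<forall>g \<in> borel_measurable M. (AE x in M. f x = g x) \<longrightarrow> g \<in> E) \<and>
     (\<lambda>x. 0) \<in> E \<and>
     (\<forall>f \<in> E. \<forall>g \<in> E. (\<lambda>x. f x + g x) \<in> E) \<and>
     (\<forall>c. \<forall>f \<in> E. (\<lambda>x. c * f x) \<in> E)"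

definition ae_norm :: "'a measure \<Rightarrow> ('a \<Rightarrow> real) set \<Rightarrow> (('a \<Rightarrow> real) \<Rightarrow> real) \<Rightarrow> bool" where
  "ae_norm M E N \<longleftrightarrow>
     (\<forall>f \<in> E. \<forall>g \<in> E. (AE x in M. f x = g x) \<longrightarrow> N f = N g) \<and>
     (\<forall>f \<in> E. N f \<ge> 0) \<and>
     (\<forall>f \<in> E. N f = 0 \<longleftrightarrow> (AE x in M. f x = 0)) \<and>
     (\<forall>c. \<forall>f \<in> E. N (\<lambda>x. c * f x) = \<bar>c\<bar> * N f) \<and>
     (\<forall>f \<in> E. \<forall>g \<in> E. N (\<lambda>x. f x + g x) \<le> N f + N g)"

definition norm_complete :: "('a \<Rightarrow> real) set \<Rightarrow> (('a \<Rightarrow> real) \<Rightarrow> real) \<Rightarrow> bool" where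
  "norm_complete E N \<longleftrightarrow>
     (\<forall>u. (\<forall>n::nat. u n \<in> E) \<and>
          (\<forall>e>0. \<exists>K. \<forall>m\<ge>K. \<forall>n\<ge>K. N (\<lambda>x. u m x - u n x) < e) \<longrightarrow>
          (\<exists>f \<in> E. (\<lambda>n. N (\<lambda>x. u n x - f x)) \<longlonglongrightarrow> 0))"

definition fully_symmetric_space ::
    "'a measure \<Rightarrow> ('a \<Rightarrow> real) set \<Rightarrow> (('a \<Rightarrow> real) \<Rightarrow> real) \<Rightarrow> bool" where
  "fully_symmetric_space M E N \<longleftrightarrow>
     ae_subspace M E \<and> ae_norm M E N \<and> norm_complete E N \<and>
     (\<forall>f \<in> E. \<forall>g \<in> L1_plus_Linf M. submajorized M g f \<longrightarrow> g \<in> E \<and> N g \<le> N f)"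


text \<open>
  The second conjunct makes \<open>T\<close> well defined on equivalence classes; values outside
  \<^term>\<open>L1_plus_Linf M\<close> are irrelevant.
\<close>

definition ae_linear_operator ::
    "'a measure \<Rightarrow> (('a \<Rightarrow> real) \<Rightarrow> ('a \<Rightarrow> real)) \<Rightarrow> bool" where
  "ae_linear_operator M T \<longleftrightarrow>
     (\<forall>f \<in> L1_plus_Linf M. T f \<in> L1_plus_Linf M) \<and>
     (\<forall>f \<in> L1_plus_Linf M. \<forall>g \<in> L1_plus_Linf M.
        (AE x in M. f x = g x) \<longrightarrow> (AE x in M. T f x = T g x)) \<and>
     (\<forall>f \<in> L1_plus_Linf M. \<forall>g \<in> L1_plus_Linf M.
        AE x in M. T (\<lambda>y. f y + g y) x = T f x + T g x) \<and>
     (\<forall>c. \<forall>f \<in> L1_plus_Linf M. AE x in M. T (\<lambda>y. c * f y) x = c * T f x)"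

definition dunford_schwartz ::
    "'a measure \<Rightarrow> (('a \<Rightarrow> real) \<Rightarrow> ('a \<Rightarrow> real)) \<Rightarrow> bool" where
  "dunford_schwartz M T \<longleftrightarrow>
     ae_linear_operator M T \<and>
     (\<forall>f \<in> L1 M. norm1 M (T f) \<le> norm1 M f) \<and>
     (\<forall>f \<in> Linf M. norm_inf M (T f) \<le> norm_inf M f)"

definition ergodic_average ::
    "(('a \<Rightarrow> real) \<Rightarrow> ('a \<Rightarrow> real)) \<Rightarrow> nat \<Rightarrow> ('a \<Rightarrow> real) \<Rightarrow> 'a \<Rightarrow> real" where
  "ergodic_average T n f x = (1 / real n) * (\<Sum>k<n. (T ^^ k) f x)"

definition individual_ergodic_property :: "'a measure \<Rightarrow> ('a \<Rightarrow> real) set \<Rightarrow> bool" where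
  "individual_ergodic_property M E \<longleftrightarrow>
     (\<forall>f \<in> E. \<forall>T. dunford_schwartz M T \<longrightarrow>
        (\<exists>fhat \<in> E. AE x in M. (\<lambda>n. ergodic_average T n f x) \<longlonglongrightarrow> fhat x))"

end

theory Submission
  imports Defs
begin

text \<open>
  The bridge between operators and rearrangements is the excess \<open>\<integral> (\<bar>f\<bar> - c)\<^sup>+\<close> above a height
  \<open>c\<close>. A Dunford-Schwartz operator does not increase it (\<open>ds_excess_le\<close>): it keeps the
  part of \<open>f\<close> cut at \<open>c\<close> below \<open>c\<close> and contracts the integrable rest. Conversely, an inequality
  between the excesses of two functions at all heights means submajorization
  (\<open>submajorized_if_excess_le\<close>).

  If \<open>E\<close> lies in \<^term>\<open>R_space M\<close>, then every \<open>f\<close> in \<open>E\<close> has finite excess above each positive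
  height, so up to a uniformly small error it is integrable, and the averages of an
  integrable function converge almost everywhere. This is the Dunford-Schwartz theorem.
  The operator may map nonnegative functions to functions of changing sign; a filling argument in
  the manner of Chacon, which measures absolute values only, gives the weak type (1,1) maximal
  inequality (\<open>maximal_inequality\<close>). By density it remains to treat bounded
  integrable \<open>f\<close>. The excess inequality makes the operator a contraction of \<open>L\<^sup>2\<close>; there the
  averages form a Cauchy sequence (\<open>L2_averages_Cauchy\<close>), and a late average is
  nearly invariant, uniformly over any given number of steps. The maximal inequality
  carries this over to all numbers of steps (\<open>nearly_convergent_L1_bounded\<close>). Fatou's lemma bounds the
  excess of the limit by that of \<open>f\<close>, so full symmetry puts the limit into \<open>E\<close>.

  If the constant 1 is in \<open>E\<close>, so is every bounded function. In a space of infinite measure there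
  are disjoint blocks of finite nondecreasing measure, and the operator that moves the mean over each
  block to the preceding block acts as the left shift on functions constant on the blocks. A
  bounded sequence with divergent Cesaro means then gives divergent averages
  (\<open>divergent_averages_of_bounded_function\<close>).

  Finally, the rearrangement of 1 is constantly 1 because the measure is infinite, so 1 is not in
  \<^term>\<open>R_space M\<close>. A rearrangement that does not vanish at infinity is bounded below by some \<open>e > 0\<close>; the
  constant \<open>e\<close> is then submajorized by the function, and 1 is in \<open>E\<close>
  (\<open>one_in_if_not_R_space\<close>).
\<close>


section \<open>Truncation and the space of integrable plus bounded functions\<close>

definition clip :: "real \<Rightarrow> real \<Rightarrow> real" where
  "clip c a = max (- c) (min c a)"

lemma abs_clip_le: "0 \<le> c \<Longrightarrow> \<bar>clip c a\<bar> \<le> c"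
  by (auto simp: clip_def)

lemma abs_clip_le_abs: "0 \<le> c \<Longrightarrow> \<bar>clip c a\<bar> \<le> \<bar>a\<bar>"
  by (auto simp: clip_def)

lemma abs_diff_clip: "0 \<le> c \<Longrightarrow> \<bar>a - clip c a\<bar> = max 0 (\<bar>a\<bar> - c)"
  by (auto simp: clip_def)

lemma ennreal_abs_diff_clip: "0 \<le> c \<Longrightarrow> ennreal \<bar>a - clip c a\<bar> = ennreal (\<bar>a\<bar> - c)"
  by (simp add: abs_diff_clip max_def ennreal_neg)

lemma abs_clip_split: "0 \<le> c \<Longrightarrow> \<bar>a\<bar> = \<bar>clip c a\<bar> + \<bar>a - clip c a\<bar>"
  by (auto simp: clip_def)

lemma clip_measurable [measurable]:
  assumes [measurable]: "c \<in> borel_measurable M" "f \<in> borel_measurable M"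
  shows "(\<lambda>x. clip (c x) (f x)) \<in> borel_measurable M"
  unfolding clip_def by measurable

lemma LinfI:
  assumes "f \<in> borel_measurable M" "AE x in M. \<bar>f x\<bar> \<le> c"
  shows "f \<in> Linf M"
proof -
  have "norm_inf M f \<le> ennreal c"
    unfolding norm_inf_def
    by (rule esssup_I) (use assms in \<open>auto intro: ennreal_leI elim!: eventually_mono\<close>)
  then show ?thesis
    using assms(1) by (auto simp: Linf_def intro: le_less_trans)
qed

lemma Linf_bounded:
  assumes "f \<in> Linf M"
  obtains c where "0 \<le> c" "AE x in M. \<bar>f x\<bar> \<le> c"
proof
  have fin: "norm_inf M f < top"
    using assms by (simp add: Linf_def)
  have "AE x in M. ennreal \<bar>f x\<bar> \<le> norm_inf M f"
    unfolding norm_inf_def by (rule esssup_AE)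
  then show "AE x in M. \<bar>f x\<bar> \<le> enn2real (norm_inf M f)"
  proof eventually_elim
    case (elim x)
    then have "ennreal \<bar>f x\<bar> \<le> ennreal (enn2real (norm_inf M f))"
      using fin by simp
    then show ?case by simp
  qed
qed simp

lemma L1_iff: "f \<in> L1 M \<longleftrightarrow> f \<in> borel_measurable M \<and> (\<integral>\<^sup>+x. ennreal \<bar>f x\<bar> \<partial>M) < \<infinity>"
  by (simp add: L1_def integrable_iff_bounded)

lemma L1_plus_Linf_measurable: "f \<in> L1_plus_Linf M \<Longrightarrow> f \<in> borel_measurable M"
  by (simp add: L1_plus_Linf_def)

text \<open>Cutting \<open>f\<close> at height \<open>c\<close> is the canonical decomposition into a bounded and an
  integrable part: if any decomposition \<open>g + h\<close> exists, then the part of \<open>f\<close> above a bound of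
  \<open>h\<close> is dominated by \<open>g\<close>.\<close>

lemma L1_plus_Linf_iff:
  "f \<in> L1_plus_Linf M \<longleftrightarrow>
     f \<in> borel_measurable M \<and> (\<exists>c\<ge>0. (\<integral>\<^sup>+x. ennreal (\<bar>f x\<bar> - c) \<partial>M) < \<infinity>)"
proof
  assume "f \<in> L1_plus_Linf M"
  then obtain g h where f: "f \<in> borel_measurable M" and g: "g \<in> L1 M" and h: "h \<in> Linf M"
    and eq: "AE x in M. f x = g x + h x"
    by (auto simp: L1_plus_Linf_def)
  obtain c where c: "0 \<le> c" "AE x in M. \<bar>h x\<bar> \<le> c"
    using Linf_bounded[OF h] .
  have "(\<integral>\<^sup>+x. ennreal (\<bar>f x\<bar> - c) \<partial>M) \<le> (\<integral>\<^sup>+x. ennreal \<bar>g x\<bar> \<partial>M)"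
    by (rule nn_integral_mono_AE) (use eq c(2) in \<open>eventually_elim, auto intro!: ennreal_leI\<close>)
  also have "\<dots> < \<infinity>"
    using g by (simp add: L1_iff)
  finally show "f \<in> borel_measurable M \<and> (\<exists>c\<ge>0. (\<integral>\<^sup>+x. ennreal (\<bar>f x\<bar> - c) \<partial>M) < \<infinity>)"
    using f c(1) by blast
next
  assume "f \<in> borel_measurable M \<and> (\<exists>c\<ge>0. (\<integral>\<^sup>+x. ennreal (\<bar>f x\<bar> - c) \<partial>M) < \<infinity>)"
  then obtain c where f [measurable]: "f \<in> borel_measurable M" and c: "0 \<le> c"
    and fin: "(\<integral>\<^sup>+x. ennreal (\<bar>f x\<bar> - c) \<partial>M) < \<infinity>"
    by blast
  have "(\<lambda>x. f x - clip c (f x)) \<in> L1 M"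
    using fin by (simp add: L1_iff ennreal_abs_diff_clip[OF c])
  moreover have "(\<lambda>x. clip c (f x)) \<in> Linf M"
    by (rule LinfI[where c = c]) (auto simp: abs_clip_le[OF c])
  ultimately show "f \<in> L1_plus_Linf M"
    unfolding L1_plus_Linf_def mem_Collect_eq
    by (intro conjI f bexI[of _ "\<lambda>x. f x - clip c (f x)"] bexI[of _ "\<lambda>x. clip c (f x)"]) simp_all
qed

lemma L1_subset: "f \<in> L1 M \<Longrightarrow> f \<in> L1_plus_Linf M"
  by (auto simp: L1_plus_Linf_iff L1_iff intro!: exI[of _ 0])

lemma bounded_in_L1_plus_Linf:
  assumes "f \<in> borel_measurable M" "AE x in M. \<bar>f x\<bar> \<le> c"
  shows "f \<in> L1_plus_Linf M"
proof -
  have "(\<integral>\<^sup>+x. ennreal (\<bar>f x\<bar> - max 0 c) \<partial>M) = (\<integral>\<^sup>+x. 0 \<partial>M)"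
    by (rule nn_integral_cong_AE) (use assms(2) in \<open>eventually_elim, auto simp: ennreal_neg\<close>)
  then show ?thesis
    using assms(1) by (auto simp: L1_plus_Linf_iff intro!: exI[of _ "max 0 c"])
qed

lemma L1_plus_Linf_add:
  assumes "f \<in> L1_plus_Linf M" "g \<in> L1_plus_Linf M"
  shows "(\<lambda>x. f x + g x) \<in> L1_plus_Linf M"
proof -
  from assms obtain c d where [measurable]: "f \<in> borel_measurable M" "g \<in> borel_measurable M"
    and c: "0 \<le> c" "(\<integral>\<^sup>+x. ennreal (\<bar>f x\<bar> - c) \<partial>M) < \<infinity>"
    and d: "0 \<le> d" "(\<integral>\<^sup>+x. ennreal (\<bar>g x\<bar> - d) \<partial>M) < \<infinity>"
    by (auto simp: L1_plus_Linf_iff)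
  have *: "ennreal (\<bar>a + b\<bar> - (c + d)) \<le> ennreal (\<bar>a\<bar> - c) + ennreal (\<bar>b\<bar> - d)" for a b
  proof -
    have "ennreal (\<bar>a + b\<bar> - (c + d)) \<le> ennreal (max 0 (\<bar>a\<bar> - c) + max 0 (\<bar>b\<bar> - d))"
      by (rule ennreal_leI) auto
    then show ?thesis
      by (simp add: ennreal_plus max_def ennreal_neg split: if_splits)
  qed
  have "(\<integral>\<^sup>+x. ennreal (\<bar>f x + g x\<bar> - (c + d)) \<partial>M)
      \<le> (\<integral>\<^sup>+x. ennreal (\<bar>f x\<bar> - c) + ennreal (\<bar>g x\<bar> - d) \<partial>M)"
    by (intro nn_integral_mono *)
  also have "\<dots> = (\<integral>\<^sup>+x. ennreal (\<bar>f x\<bar> - c) \<partial>M) + (\<integral>\<^sup>+x. ennreal (\<bar>g x\<bar> - d) \<partial>M)"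
    by (rule nn_integral_add) auto
  also have "\<dots> < \<infinity>"
    using c d by simp
  finally show ?thesis
    using c(1) d(1) by (auto simp: L1_plus_Linf_iff intro!: exI[of _ "c + d"])
qed

lemma L1_plus_Linf_cmult:
  assumes "f \<in> L1_plus_Linf M"
  shows "(\<lambda>x. a * f x) \<in> L1_plus_Linf M"
proof -
  from assms obtain c where [measurable]: "f \<in> borel_measurable M"
    and c: "0 \<le> c" "(\<integral>\<^sup>+x. ennreal (\<bar>f x\<bar> - c) \<partial>M) < \<infinity>"
    by (auto simp: L1_plus_Linf_iff)
  have "(\<integral>\<^sup>+x. ennreal (\<bar>a * f x\<bar> - \<bar>a\<bar> * c) \<partial>M)
      = (\<integral>\<^sup>+x. ennreal \<bar>a\<bar> * ennreal (\<bar>f x\<bar> - c) \<partial>M)"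
    by (simp add: ennreal_mult'[symmetric] abs_mult right_diff_distrib)
  also have "\<dots> = ennreal \<bar>a\<bar> * (\<integral>\<^sup>+x. ennreal (\<bar>f x\<bar> - c) \<partial>M)"
    by (rule nn_integral_cmult) auto
  also have "\<dots> < \<infinity>"
    using c by (simp add: ennreal_mult_less_top)
  finally show ?thesis
    using c(1) by (auto simp: L1_plus_Linf_iff intro!: exI[of _ "\<bar>a\<bar> * c"])
qed

lemma L1_plus_Linf_diff:
  "f \<in> L1_plus_Linf M \<Longrightarrow> g \<in> L1_plus_Linf M \<Longrightarrow> (\<lambda>x. f x - g x) \<in> L1_plus_Linf M"
  using L1_plus_Linf_add[of f M "\<lambda>x. - 1 * g x"] L1_plus_Linf_cmult[of g M "- 1"] by simp

lemma L1_plus_Linf_sum: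
  "(\<And>i. i \<in> I \<Longrightarrow> f i \<in> L1_plus_Linf M) \<Longrightarrow> (\<lambda>x. \<Sum>i\<in>I. f i x) \<in> L1_plus_Linf M"
proof (induction I rule: infinite_finite_induct)
  case (insert i I)
  then show ?case by (simp add: L1_plus_Linf_add)
qed (simp_all add: bounded_in_L1_plus_Linf[where c = 0])

section \<open>Dunford-Schwartz operators\<close>

lemma ds_L1_plus_Linf: "dunford_schwartz M T \<Longrightarrow> f \<in> L1_plus_Linf M \<Longrightarrow> T f \<in> L1_plus_Linf M"
  by (simp add: dunford_schwartz_def ae_linear_operator_def)

lemma ds_measurable: "dunford_schwartz M T \<Longrightarrow> f \<in> L1_plus_Linf M \<Longrightarrow> T f \<in> borel_measurable M"
  by (rule L1_plus_Linf_measurable[OF ds_L1_plus_Linf])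

lemma ds_cong:
  "dunford_schwartz M T \<Longrightarrow> f \<in> L1_plus_Linf M \<Longrightarrow> g \<in> L1_plus_Linf M \<Longrightarrow>
     AE x in M. f x = g x \<Longrightarrow> AE x in M. T f x = T g x"
  by (simp add: dunford_schwartz_def ae_linear_operator_def)

lemma ds_add:
  "dunford_schwartz M T \<Longrightarrow> f \<in> L1_plus_Linf M \<Longrightarrow> g \<in> L1_plus_Linf M \<Longrightarrow>
     AE x in M. T (\<lambda>y. f y + g y) x = T f x + T g x"
  by (simp add: dunford_schwartz_def ae_linear_operator_def)

lemma ds_cmult:
  "dunford_schwartz M T \<Longrightarrow> f \<in> L1_plus_Linf M \<Longrightarrow> AE x in M. T (\<lambda>y. c * f y) x = c * T f x"
  by (simp add: dunford_schwartz_def ae_linear_operator_def)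

lemma ds_diff:
  assumes T: "dunford_schwartz M T" and f: "f \<in> L1_plus_Linf M" and g: "g \<in> L1_plus_Linf M"
  shows "AE x in M. T (\<lambda>y. f y - g y) x = T f x - T g x"
  using ds_add[OF T f L1_plus_Linf_cmult[OF g, of "- 1"]] ds_cmult[OF T g, of "- 1"]
  by eventually_elim simp

lemma ds_zero:
  assumes T: "dunford_schwartz M T"
  shows "AE x in M. T (\<lambda>y. 0) x = 0"
  using ds_cmult[OF T bounded_in_L1_plus_Linf[of "\<lambda>_. 0" M 0], of 0] by simp

lemma ds_sum:
  assumes T: "dunford_schwartz M T" and "finite I" and f: "\<And>i. i \<in> I \<Longrightarrow> f i \<in> L1_plus_Linf M"
  shows "AE x in M. T (\<lambda>y. \<Sum>i\<in>I. f i y) x = (\<Sum>i\<in>I. T (f i) x)"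
  using assms(2) f
proof (induction I)
  case empty
  then show ?case using ds_zero[OF T] by simp
next
  case (insert i I)
  have "AE x in M. T (\<lambda>y. f i y + (\<Sum>i\<in>I. f i y)) x = T (f i) x + T (\<lambda>y. \<Sum>i\<in>I. f i y) x"
    by (rule ds_add[OF T insert.prems L1_plus_Linf_sum]) (use insert.prems in blast)+
  moreover have "AE x in M. T (\<lambda>y. \<Sum>i\<in>I. f i y) x = (\<Sum>i\<in>I. T (f i) x)"
    by (rule insert.IH) (use insert.prems in blast)
  ultimately show ?case
    by eventually_elim (simp add: insert.hyps)
qed

lemma ds_nn_integral_abs_le:
  "dunford_schwartz M T \<Longrightarrow> f \<in> L1 M \<Longrightarrow>
     (\<integral>\<^sup>+x. ennreal \<bar>T f x\<bar> \<partial>M) \<le> (\<integral>\<^sup>+x. ennreal \<bar>f x\<bar> \<partial>M)"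
  by (simp add: dunford_schwartz_def norm1_def)

lemma ds_L1: "dunford_schwartz M T \<Longrightarrow> f \<in> L1 M \<Longrightarrow> T f \<in> L1 M"
  using ds_nn_integral_abs_le[of M T f] ds_measurable[of M T f] L1_subset[of f M]
  by (auto simp: L1_iff)

lemma ds_AE_bounded:
  assumes T: "dunford_schwartz M T" and f: "f \<in> borel_measurable M"
    and c: "0 \<le> c" "AE x in M. \<bar>f x\<bar> \<le> c"
  shows "AE x in M. \<bar>T f x\<bar> \<le> c"
proof -
  have "norm_inf M (T f) \<le> norm_inf M f"
    using T LinfI[OF f c(2)] by (simp add: dunford_schwartz_def)
  also have "\<dots> \<le> ennreal c"
    unfolding norm_inf_def
    by (rule esssup_I) (use f c in \<open>auto intro: ennreal_leI elim!: eventually_mono\<close>)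
  finally have le: "norm_inf M (T f) \<le> ennreal c" .
  have "AE x in M. ennreal \<bar>T f x\<bar> \<le> norm_inf M (T f)"
    unfolding norm_inf_def by (rule esssup_AE)
  then show ?thesis
  proof eventually_elim
    case (elim x)
    then have "ennreal \<bar>T f x\<bar> \<le> ennreal c"
      using le by (rule order_trans)
    then show ?case using c(1) by simp
  qed
qed

lemma dunford_schwartzI:
  assumes "\<And>f. f \<in> L1_plus_Linf M \<Longrightarrow> T f \<in> L1_plus_Linf M"
    and "\<And>f g. f \<in> L1_plus_Linf M \<Longrightarrow> g \<in> L1_plus_Linf M \<Longrightarrow> AE x in M. f x = g x \<Longrightarrow>
           AE x in M. T f x = T g x"
    and "\<And>f g. f \<in> L1_plus_Linf M \<Longrightarrow> g \<in> L1_plus_Linf M \<Longrightarrow>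
           AE x in M. T (\<lambda>y. f y + g y) x = T f x + T g x"
    and "\<And>c f. f \<in> L1_plus_Linf M \<Longrightarrow> AE x in M. T (\<lambda>y. c * f y) x = c * T f x"
    and "\<And>f. f \<in> L1 M \<Longrightarrow> (\<integral>\<^sup>+x. ennreal \<bar>T f x\<bar> \<partial>M) \<le> (\<integral>\<^sup>+x. ennreal \<bar>f x\<bar> \<partial>M)"
    and bounded: "\<And>f c. f \<in> borel_measurable M \<Longrightarrow> 0 \<le> c \<Longrightarrow> AE x in M. \<bar>f x\<bar> \<le> c \<Longrightarrow>
           AE x in M. \<bar>T f x\<bar> \<le> c"
  shows "dunford_schwartz M T"
proof -
  have "norm_inf M (T f) \<le> norm_inf M f" if "f \<in> Linf M" for f
  proof -
    have f: "f \<in> borel_measurable M" and fin: "norm_inf M f < top"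
      using that by (auto simp: Linf_def)
    have f': "AE x in M. ennreal \<bar>f x\<bar> \<le> norm_inf M f"
      unfolding norm_inf_def by (rule esssup_AE)
    have eq: "ennreal (enn2real (norm_inf M f)) = norm_inf M f"
      using fin by simp
    have AE_f: "AE x in M. \<bar>f x\<bar> \<le> enn2real (norm_inf M f)"
      using f' by eventually_elim (metis enn2real_ennreal abs_ge_zero enn2real_mono fin)
    have "T f \<in> borel_measurable M"
      using assms(1) bounded_in_L1_plus_Linf[OF f AE_f] L1_plus_Linf_measurable by blast
    moreover have "AE x in M. \<bar>T f x\<bar> \<le> enn2real (norm_inf M f)"
      using bounded[OF f _ AE_f] by simp
    ultimately have "norm_inf M (T f) \<le> ennreal (enn2real (norm_inf M f))"
      unfolding norm_inf_def
      by (intro esssup_I) (auto elim!: eventually_mono intro!: ennreal_leI)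
    then show ?thesis
      by (simp add: eq)
  qed
  then show ?thesis
    using assms by (simp add: dunford_schwartz_def ae_linear_operator_def norm1_def)
qed

lemma ds_comp:
  assumes T: "dunford_schwartz M T" and S: "dunford_schwartz M S"
  shows "dunford_schwartz M (\<lambda>f. T (S f))"
proof (rule dunford_schwartzI)
  note X = ds_L1_plus_Linf[OF T] ds_L1_plus_Linf[OF S]
  note closed = L1_plus_Linf_add L1_plus_Linf_cmult
  show "T (S f) \<in> L1_plus_Linf M" if "f \<in> L1_plus_Linf M" for f
    by (intro X that)
  show "AE x in M. T (S f) x = T (S g) x"
    if "f \<in> L1_plus_Linf M" "g \<in> L1_plus_Linf M" "AE x in M. f x = g x" for f g
    by (intro ds_cong[OF T] ds_cong[OF S] X that)
  show "AE x in M. T (S (\<lambda>y. f y + g y)) x = T (S f) x + T (S g) x"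
    if f: "f \<in> L1_plus_Linf M" and g: "g \<in> L1_plus_Linf M" for f g
  proof -
    have "AE x in M. T (S (\<lambda>y. f y + g y)) x = T (\<lambda>y. S f y + S g y) x"
      by (intro ds_cong[OF T] ds_add[OF S] X closed f g)
    moreover have "AE x in M. T (\<lambda>y. S f y + S g y) x = T (S f) x + T (S g) x"
      by (intro ds_add[OF T] X f g)
    ultimately show ?thesis by eventually_elim simp
  qed
  show "AE x in M. T (S (\<lambda>y. c * f y)) x = c * T (S f) x" if f: "f \<in> L1_plus_Linf M" for c f
  proof -
    have "AE x in M. T (S (\<lambda>y. c * f y)) x = T (\<lambda>y. c * S f y) x"
      by (intro ds_cong[OF T] ds_cmult[OF S] X closed f)
    moreover have "AE x in M. T (\<lambda>y. c * S f y) x = c * T (S f) x"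
      by (intro ds_cmult[OF T] X f)
    ultimately show ?thesis by eventually_elim simp
  qed
  show "(\<integral>\<^sup>+x. ennreal \<bar>T (S f) x\<bar> \<partial>M) \<le> (\<integral>\<^sup>+x. ennreal \<bar>f x\<bar> \<partial>M)" if "f \<in> L1 M" for f
    using ds_nn_integral_abs_le[OF T ds_L1[OF S that]] ds_nn_integral_abs_le[OF S that]
    by (rule order_trans)
  show "AE x in M. \<bar>T (S f) x\<bar> \<le> c"
    if "f \<in> borel_measurable M" "0 \<le> c" "AE x in M. \<bar>f x\<bar> \<le> c" for f c
    using that
    by (intro ds_AE_bounded[OF T] ds_AE_bounded[OF S] ds_measurable[OF S])
       (auto intro: bounded_in_L1_plus_Linf)
qed

lemma ds_funpow:
  assumes T: "dunford_schwartz M T"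
  shows "dunford_schwartz M (T ^^ k)"
proof (induction k)
  case 0
  have "dunford_schwartz M (\<lambda>f. f)"
    by (rule dunford_schwartzI) auto
  then show ?case by (simp add: id_def)
next
  case (Suc k)
  then show ?case using ds_comp[OF T Suc] by (simp add: comp_def)
qed

lemma ergodic_average_bound:
  assumes c: "0 \<le> c" and le: "\<And>k. k < n \<Longrightarrow> \<bar>(T ^^ k) f x\<bar> \<le> c"
  shows "\<bar>ergodic_average T n f x\<bar> \<le> c"
proof (cases "n = 0")
  case True
  then show ?thesis using c by (simp add: ergodic_average_def)
next
  case False
  have "\<bar>\<Sum>k<n. (T ^^ k) f x\<bar> \<le> (\<Sum>k<n. c)"
    by (rule order_trans[OF sum_abs sum_mono]) (use le in simp)
  then show ?thesis
    using False by (simp add: ergodic_average_def abs_mult field_simps)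
qed

text \<open>Through this lemma each estimate for Dunford-Schwartz operators, and almost everywhere
  linearity, applies directly to the averages.\<close>

lemma ds_ergodic_average:
  assumes T: "dunford_schwartz M T"
  shows "dunford_schwartz M (ergodic_average T n)"
proof (rule dunford_schwartzI)
  note pow = ds_funpow[OF T]
  show X: "ergodic_average T n f \<in> L1_plus_Linf M" if "f \<in> L1_plus_Linf M" for f
    unfolding ergodic_average_def[abs_def]
    by (intro L1_plus_Linf_cmult L1_plus_Linf_sum ds_L1_plus_Linf[OF pow] that)
  show "AE x in M. ergodic_average T n f x = ergodic_average T n g x"
    if "f \<in> L1_plus_Linf M" "g \<in> L1_plus_Linf M" "AE x in M. f x = g x" for f g
  proof -
    have "AE x in M. \<forall>k. (T ^^ k) f x = (T ^^ k) g x"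
      unfolding AE_all_countable by (intro allI ds_cong[OF pow] that)
    then show ?thesis by eventually_elim (simp add: ergodic_average_def)
  qed
  show "AE x in M. ergodic_average T n (\<lambda>y. f y + g y) x
      = ergodic_average T n f x + ergodic_average T n g x"
    if "f \<in> L1_plus_Linf M" "g \<in> L1_plus_Linf M" for f g
  proof -
    have "AE x in M. \<forall>k. (T ^^ k) (\<lambda>y. f y + g y) x = (T ^^ k) f x + (T ^^ k) g x"
      unfolding AE_all_countable by (intro allI ds_add[OF pow] that)
    then show ?thesis
      by eventually_elim (simp add: ergodic_average_def sum.distrib distrib_left)
  qed
  show "AE x in M. ergodic_average T n (\<lambda>y. c * f y) x = c * ergodic_average T n f x"
    if "f \<in> L1_plus_Linf M" for c f
  proof -
    have "AE x in M. \<forall>k. (T ^^ k) (\<lambda>y. c * f y) x = c * (T ^^ k) f x"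
      unfolding AE_all_countable by (intro allI ds_cmult[OF pow] that)
    then show ?thesis
      by eventually_elim (simp add: ergodic_average_def sum_distrib_left mult_ac)
  qed
  show "AE x in M. \<bar>ergodic_average T n f x\<bar> \<le> c"
    if "f \<in> borel_measurable M" "0 \<le> c" "AE x in M. \<bar>f x\<bar> \<le> c" for f c
  proof -
    have "AE x in M. \<forall>k. \<bar>(T ^^ k) f x\<bar> \<le> c"
      unfolding AE_all_countable by (intro allI ds_AE_bounded[OF pow] that)
    then show ?thesis
      by eventually_elim (rule ergodic_average_bound, use that in auto)
  qed
  show "(\<integral>\<^sup>+x. ennreal \<bar>ergodic_average T n f x\<bar> \<partial>M) \<le> (\<integral>\<^sup>+x. ennreal \<bar>f x\<bar> \<partial>M)"
    if f: "f \<in> L1 M" for f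
  proof -
    have [measurable]: "(T ^^ k) f \<in> borel_measurable M" for k
      by (intro ds_measurable[OF pow] L1_subset f)
    have "(\<integral>\<^sup>+x. ennreal \<bar>ergodic_average T n f x\<bar> \<partial>M)
        \<le> (\<integral>\<^sup>+x. ennreal (1 / real n) * (\<Sum>k<n. ennreal \<bar>(T ^^ k) f x\<bar>) \<partial>M)"
      by (intro nn_integral_mono)
         (auto simp: ergodic_average_def abs_mult sum_ennreal ennreal_mult'[symmetric]
           intro!: ennreal_leI divide_right_mono sum_abs)
    also have "\<dots> = ennreal (1 / real n) * (\<Sum>k<n. \<integral>\<^sup>+x. ennreal \<bar>(T ^^ k) f x\<bar> \<partial>M)"
      by (subst nn_integral_cmult, simp, subst nn_integral_sum) simp_all
    also have "\<dots> \<le> ennreal (1 / real n) * (\<Sum>k<n. \<integral>\<^sup>+x. ennreal \<bar>f x\<bar> \<partial>M)"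
      by (intro mult_left_mono sum_mono ds_nn_integral_abs_le[OF pow] f) simp
    also have "\<dots> = ennreal (1 / real n) * ennreal (real n) * (\<integral>\<^sup>+x. ennreal \<bar>f x\<bar> \<partial>M)"
      by (simp add: mult.assoc ennreal_of_nat_eq_real_of_nat)
    also have "\<dots> \<le> 1 * (\<integral>\<^sup>+x. ennreal \<bar>f x\<bar> \<partial>M)"
      by (intro mult_right_mono) (auto simp: ennreal_mult'[symmetric] simp del: ennreal_1)
    finally show ?thesis by simp
  qed
qed

text \<open>Cutting \<open>f\<close> at height \<open>c\<close>, the operator keeps the bounded part below \<open>c\<close> and contracts the
  integrable rest; so the mass of \<open>T f\<close> above each height is at most that of \<open>f\<close>. Through the
  layer-cake formulas this single inequality yields both the \<open>L\<^sup>2\<close> contraction and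
  submajorization.\<close>

lemma ds_excess_le:
  assumes T: "dunford_schwartz M T" and f: "f \<in> L1_plus_Linf M" and c: "0 \<le> c"
  shows "(\<integral>\<^sup>+x. ennreal (\<bar>T f x\<bar> - c) \<partial>M) \<le> (\<integral>\<^sup>+x. ennreal (\<bar>f x\<bar> - c) \<partial>M)"
proof (cases "(\<integral>\<^sup>+x. ennreal (\<bar>f x\<bar> - c) \<partial>M) < \<infinity>")
  case False
  then show ?thesis by (simp add: less_top[symmetric])
next
  case True
  have [measurable]: "f \<in> borel_measurable M"
    using f by (rule L1_plus_Linf_measurable)
  let ?b = "\<lambda>x. clip c (f x)" and ?r = "\<lambda>x. f x - clip c (f x)"
  have r: "?r \<in> L1 M"
    using True by (simp add: L1_iff ennreal_abs_diff_clip[OF c])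
  have b: "?b \<in> L1_plus_Linf M"
    by (rule bounded_in_L1_plus_Linf[where c = c]) (auto simp: abs_clip_le[OF c])
  have "AE x in M. T (\<lambda>y. ?b y + ?r y) x = T ?b x + T ?r x"
    by (rule ds_add[OF T b L1_subset[OF r]])
  moreover have "AE x in M. \<bar>T ?b x\<bar> \<le> c"
    by (rule ds_AE_bounded[OF T]) (auto simp: abs_clip_le[OF c] c)
  ultimately have "AE x in M. ennreal (\<bar>T f x\<bar> - c) \<le> ennreal \<bar>T ?r x\<bar>"
    by eventually_elim (auto intro!: ennreal_leI)
  then have "(\<integral>\<^sup>+x. ennreal (\<bar>T f x\<bar> - c) \<partial>M) \<le> (\<integral>\<^sup>+x. ennreal \<bar>T ?r x\<bar> \<partial>M)"
    by (rule nn_integral_mono_AE)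
  also have "\<dots> \<le> (\<integral>\<^sup>+x. ennreal \<bar>?r x\<bar> \<partial>M)"
    by (rule ds_nn_integral_abs_le[OF T r])
  finally show ?thesis
    by (simp add: ennreal_abs_diff_clip[OF c])
qed

text \<open>Integrating \<open>(\<bar>a\<bar> - l)\<^sup>+\<close> over all heights \<open>l \<ge> 0\<close> gives half the square; this turns the excess
  inequality into an inequality of \<open>L\<^sup>2\<close> norms.\<close>

lemma square_layers:
  "(\<integral>\<^sup>+l. ennreal (\<bar>a\<bar> - l) * indicator {0..} l \<partial>lborel) = ennreal (a\<^sup>2 / 2)"
proof -
  have "(\<integral>\<^sup>+l. ennreal (\<bar>a\<bar> - l) * indicator {0..} l \<partial>lborel)
      = (\<integral>\<^sup>+l. ennreal (\<bar>a\<bar> - l) * indicator {0..\<bar>a\<bar>} l \<partial>lborel)"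
    by (intro nn_integral_cong) (auto simp: indicator_def ennreal_neg)
  also have "\<dots> = ennreal ((\<bar>a\<bar> * \<bar>a\<bar> - \<bar>a\<bar>\<^sup>2 / 2) - (\<bar>a\<bar> * 0 - 0\<^sup>2 / 2))"
    by (rule nn_integral_FTC_Icc[where F = "\<lambda>l. \<bar>a\<bar> * l - l\<^sup>2 / 2"])
       (auto intro!: derivative_eq_intros)
  finally show ?thesis
    by (simp add: power2_eq_square)
qed

lemma nn_integral_square_layers:
  assumes M: "sigma_finite_measure M" and f [measurable]: "f \<in> borel_measurable M"
  shows "(\<integral>\<^sup>+x. ennreal ((f x)\<^sup>2 / 2) \<partial>M)
       = (\<integral>\<^sup>+l. (\<integral>\<^sup>+x. ennreal (\<bar>f x\<bar> - l) \<partial>M) * indicator {0..} l \<partial>lborel)"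
proof -
  interpret sigma_finite_measure M by fact
  interpret P: pair_sigma_finite M lborel ..
  have "(\<integral>\<^sup>+x. ennreal ((f x)\<^sup>2 / 2) \<partial>M)
      = (\<integral>\<^sup>+x. (\<integral>\<^sup>+l. ennreal (\<bar>f x\<bar> - l) * indicator {0..} l \<partial>lborel) \<partial>M)"
    by (simp add: square_layers)
  also have "\<dots> = (\<integral>\<^sup>+l. (\<integral>\<^sup>+x. ennreal (\<bar>f x\<bar> - l) * indicator {0..} l \<partial>M) \<partial>lborel)"
    by (rule P.Fubini'[symmetric]) measurable
  finally show ?thesis
    by (simp add: nn_integral_multc)
qed

lemma ds_L2_contraction:
  assumes M: "sigma_finite_measure M" and T: "dunford_schwartz M T" and f: "f \<in> L1_plus_Linf M"
  shows "(\<integral>\<^sup>+x. ennreal ((T f x)\<^sup>2) \<partial>M) \<le> (\<integral>\<^sup>+x. ennreal ((f x)\<^sup>2) \<partial>M)"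
proof -
  note [measurable] = L1_plus_Linf_measurable[OF f] ds_measurable[OF T f]
  have half: "(\<integral>\<^sup>+x. ennreal ((g x)\<^sup>2) \<partial>M) = 2 * (\<integral>\<^sup>+x. ennreal ((g x)\<^sup>2 / 2) \<partial>M)"
    if [measurable]: "g \<in> borel_measurable M" for g :: "'a \<Rightarrow> real"
    by (subst nn_integral_cmult[symmetric])
       (auto simp: ennreal_mult'[symmetric] ennreal_numeral[symmetric] simp del: ennreal_numeral)
  have "(\<integral>\<^sup>+x. ennreal ((T f x)\<^sup>2 / 2) \<partial>M) \<le> (\<integral>\<^sup>+x. ennreal ((f x)\<^sup>2 / 2) \<partial>M)"
    unfolding nn_integral_square_layers[OF M ds_measurable[OF T f]]
      nn_integral_square_layers[OF M L1_plus_Linf_measurable[OF f]]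
    by (intro nn_integral_mono) (auto simp: indicator_def ds_excess_le[OF T f])
  then show ?thesis
    by (simp add: half mult_left_mono)
qed

section \<open>The maximal inequality\<close>

text \<open>At each point a container of size \<open>a\<close> is filled step by step. The pair of step \<open>k\<close> consists
  of the incoming function and of the amount already used; as much of the incoming
  function as the remaining room permits is kept, and the operator moves on what overflows. The
  amount used counts absolute values, since kept portions of opposite sign may not
  cancel.\<close>

primrec filling ::
    "(('a \<Rightarrow> real) \<Rightarrow> 'a \<Rightarrow> real) \<Rightarrow> real \<Rightarrow> ('a \<Rightarrow> real) \<Rightarrow> nat \<Rightarrow> ('a \<Rightarrow> real) \<times> ('a \<Rightarrow> real)" where
  "filling T a f 0 = (f, \<lambda>x. 0)"
| "filling T a f (Suc k) =
     (let (u, v) = filling T a f k; d = (\<lambda>x. clip (a - v x) (u x))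
      in (T (\<lambda>x. u x - d x), \<lambda>x. v x + \<bar>d x\<bar>))"

lemma sum_triangle_swap:
  fixes h :: "nat \<Rightarrow> nat \<Rightarrow> real"
  shows "(\<Sum>k<n. \<Sum>i\<le>k. h i (k - i)) = (\<Sum>i<n. \<Sum>j<n - i. h i j)"
proof -
  have "(\<Sum>k<n. \<Sum>i\<le>k. h i (k - i)) = (\<Sum>(i,j)\<in>{(i,j). i + j < n}. h i j)"
    by (rule sum.triangle_reindex[symmetric])
  also have "{(i,j). i + j < n} = Sigma {..<n} (\<lambda>i. {..<n - i})"
    by auto
  finally show ?thesis
    by (simp add: sum.Sigma)
qed

text \<open>With \<open>d\<^sub>k\<close> the portion kept in step \<open>k\<close> and \<open>r\<^sub>k\<close> the overflow,
  \<open>T\<^sup>k f = r\<^sub>k + \<Sum>i\<le>k. T\<^sup>i d\<^bsub>k-i\<^esub>\<close>, so summing over \<open>k < n\<close> gives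
  \<open>\<Sum>k<n. r\<^sub>k + \<Sum>i<n. T\<^sup>i (\<Sum>j<n-i. d\<^sub>j)\<close>. Every inner sum is at most \<open>a\<close> in absolute value,
  and so is its image under the \<open>L\<^sup>\<infinity>\<close> contraction \<open>T\<^sup>i\<close>; hence the averages stay below \<open>a\<close>
  wherever nothing ever overflows. Overflow occurs only in full containers, and the
  containers hold in total at most the mass of \<open>f\<close> because \<open>T\<close> contracts \<open>L\<^sup>1\<close>.\<close>

lemma maximal_inequality:
  assumes T: "dunford_schwartz M T" and f: "f \<in> L1 M" and a: "0 < a"
  obtains B where "B \<in> sets M"
    and "ennreal a * emeasure M B \<le> (\<integral>\<^sup>+x. ennreal \<bar>f x\<bar> \<partial>M)"
    and "AE x in M. x \<notin> B \<longrightarrow> (\<forall>n. \<bar>ergodic_average T n f x\<bar> \<le> a)"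
proof -
  note pow = ds_funpow[OF T]
  define u where "u k = fst (filling T a f k)" for k
  define v where "v k = snd (filling T a f k)" for k
  define d where "d k x = clip (a - v k x) (u k x)" for k x
  define r where "r k x = u k x - d k x" for k x
  have u_0: "u 0 = f" and v_0: "v 0 x = 0" for x
    by (simp_all add: u_def v_def)
  have u_Suc: "u (Suc k) = T (r k)" for k
    by (simp add: u_def v_def d_def[abs_def] r_def[abs_def] case_prod_beta Let_def)
  have v_Suc: "v (Suc k) x = v k x + \<bar>d k x\<bar>" for k x
    by (simp add: u_def v_def d_def[abs_def] case_prod_beta Let_def)
  have v_le: "v k x \<le> a" for k x
  proof (induction k)
    case (Suc k)
    then show ?case using abs_clip_le[of "a - v k x" "u k x"] by (simp add: v_Suc d_def)
  qed (use a in \<open>simp add: v_0\<close>)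
  have split: "\<bar>u k x\<bar> = \<bar>d k x\<bar> + \<bar>r k x\<bar>" for k x
    unfolding d_def r_def by (rule abs_clip_split) (use v_le[of k x] in simp)
  have full: "v (Suc k) x = a" if "r k x \<noteq> 0" for k x
    using that v_le[of k x] by (auto simp: v_Suc r_def d_def clip_def max_def min_def split: if_splits)

  have u_L1: "u k \<in> L1 M \<and> v k \<in> borel_measurable M" for k
  proof (induction k)
    case 0
    then show ?case using f by (simp add: u_0 v_0[abs_def])
  next
    case (Suc k)
    then have [measurable]: "u k \<in> borel_measurable M" "v k \<in> borel_measurable M"
      and u: "(\<integral>\<^sup>+x. ennreal \<bar>u k x\<bar> \<partial>M) < \<infinity>"
      by (auto simp: L1_iff)
    have [measurable]: "d k \<in> borel_measurable M"
      unfolding d_def[abs_def] by measurable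
    have [measurable]: "r k \<in> borel_measurable M"
      unfolding r_def[abs_def] by measurable
    have "(\<integral>\<^sup>+x. ennreal \<bar>r k x\<bar> \<partial>M) \<le> (\<integral>\<^sup>+x. ennreal \<bar>u k x\<bar> \<partial>M)"
      by (intro nn_integral_mono ennreal_leI) (simp add: split)
    then have "r k \<in> L1 M"
      using u by (simp add: L1_iff)
    then show ?case
      by (simp add: u_Suc ds_L1[OF T] v_Suc[abs_def])
  qed
  then have [measurable]: "u k \<in> borel_measurable M" "v k \<in> borel_measurable M" for k
    by (auto simp: L1_iff)
  have d_meas [measurable]: "d k \<in> borel_measurable M" for k
    unfolding d_def[abs_def] by measurable
  have r_meas [measurable]: "r k \<in> borel_measurable M" for k
    unfolding r_def[abs_def] by measurable
  have r_L1: "r k \<in> L1 M" and d_L1: "d k \<in> L1 M" for k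
  proof -
    have "(\<integral>\<^sup>+x. ennreal \<bar>u k x\<bar> \<partial>M) < \<infinity>"
      using u_L1[of k] by (simp add: L1_iff)
    moreover have "(\<integral>\<^sup>+x. ennreal \<bar>r k x\<bar> \<partial>M) \<le> (\<integral>\<^sup>+x. ennreal \<bar>u k x\<bar> \<partial>M)"
      "(\<integral>\<^sup>+x. ennreal \<bar>d k x\<bar> \<partial>M) \<le> (\<integral>\<^sup>+x. ennreal \<bar>u k x\<bar> \<partial>M)"
      by (intro nn_integral_mono ennreal_leI; simp add: split)+
    ultimately show "r k \<in> L1 M" "d k \<in> L1 M"
      by (auto simp: L1_iff)
  qed
  note d_X = L1_subset[OF d_L1] and r_X = L1_subset[OF r_L1]

  have v_nonneg: "0 \<le> v k x" for k x
    by (induction k) (simp_all add: v_0 v_Suc)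
  have v_mono: "v k x \<le> v m x" if "k \<le> m" for k m x
    by (rule lift_Suc_mono_le[of "\<lambda>k. v k x", OF _ that]) (simp add: v_Suc)
  \<comment> \<open>Capacity already used plus mass still moving never grows.\<close>
  have mass: "(\<integral>\<^sup>+x. ennreal (v k x) \<partial>M) + (\<integral>\<^sup>+x. ennreal \<bar>u k x\<bar> \<partial>M) \<le> (\<integral>\<^sup>+x. ennreal \<bar>f x\<bar> \<partial>M)"
    for k
  proof (induction k)
    case (Suc k)
    have "(\<integral>\<^sup>+x. ennreal (v (Suc k) x) \<partial>M) + (\<integral>\<^sup>+x. ennreal \<bar>u (Suc k) x\<bar> \<partial>M)
        \<le> (\<integral>\<^sup>+x. ennreal (v (Suc k) x) \<partial>M) + (\<integral>\<^sup>+x. ennreal \<bar>r k x\<bar> \<partial>M)"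
      unfolding u_Suc by (intro add_left_mono ds_nn_integral_abs_le[OF T r_L1])
    also have "\<dots> = (\<integral>\<^sup>+x. ennreal (v (Suc k) x) + ennreal \<bar>r k x\<bar> \<partial>M)"
      by (rule nn_integral_add[symmetric]) auto
    also have "\<dots> = (\<integral>\<^sup>+x. ennreal (v k x) + ennreal \<bar>u k x\<bar> \<partial>M)"
      by (intro nn_integral_cong) (simp add: v_Suc split v_nonneg ennreal_plus[symmetric] del: ennreal_plus)
    also have "\<dots> = (\<integral>\<^sup>+x. ennreal (v k x) \<partial>M) + (\<integral>\<^sup>+x. ennreal \<bar>u k x\<bar> \<partial>M)"
      by (rule nn_integral_add) auto
    finally show ?case using Suc by (rule order_trans)
  qed (simp add: u_0 v_0)

  \<comment> \<open>A point whose container is not full when step \<open>k + 1\<close> begins had no overflow in step \<open>k\<close>.\<close>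
  define B where "B k = {x \<in> space M. v k x = a}" for k
  have [measurable]: "B k \<in> sets M" for k
    unfolding B_def by measurable
  have "incseq B"
  proof (rule incseq_SucI)
    fix k show "B k \<subseteq> B (Suc k)"
      using v_mono[of k "Suc k"] v_le[of "Suc k"] unfolding B_def by (force intro: antisym)
  qed
  have B_le: "ennreal a * emeasure M (B k) \<le> (\<integral>\<^sup>+x. ennreal \<bar>f x\<bar> \<partial>M)" for k
  proof -
    have "ennreal a * emeasure M (B k) = (\<integral>\<^sup>+x. ennreal a * indicator (B k) x \<partial>M)"
      by (simp add: nn_integral_cmult_indicator)
    also have "\<dots> \<le> (\<integral>\<^sup>+x. ennreal (v k x) \<partial>M)"
      by (intro nn_integral_mono) (auto simp: B_def indicator_def)
    also have "\<dots> \<le> (\<integral>\<^sup>+x. ennreal (v k x) \<partial>M) + (\<integral>\<^sup>+x. ennreal \<bar>u k x\<bar> \<partial>M)"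
      by simp
    also have "\<dots> \<le> (\<integral>\<^sup>+x. ennreal \<bar>f x\<bar> \<partial>M)"
      by (rule mass)
    finally show ?thesis .
  qed

  have decomp: "AE x in M. (T ^^ k) f x = (\<Sum>i\<le>k. (T ^^ i) (d (k - i)) x) + r k x" for k
  proof (induction k)
    case (Suc k)
    let ?g = "\<lambda>i. (T ^^ i) (d (k - i))"
    have g: "?g i \<in> L1_plus_Linf M" for i
      by (rule ds_L1_plus_Linf[OF pow d_X])
    have sum: "(\<lambda>x. \<Sum>i\<le>k. ?g i x) \<in> L1_plus_Linf M"
      by (intro L1_plus_Linf_sum g)
    have "AE x in M. T ((T ^^ k) f) x = T (\<lambda>y. (\<Sum>i\<le>k. ?g i y) + r k y) x"
      by (rule ds_cong[OF T ds_L1_plus_Linf[OF pow L1_subset[OF f]] L1_plus_Linf_add[OF sum r_X] Suc])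
    moreover have "AE x in M. T (\<lambda>y. (\<Sum>i\<le>k. ?g i y) + r k y) x
        = T (\<lambda>y. \<Sum>i\<le>k. ?g i y) x + T (r k) x"
      by (rule ds_add[OF T sum r_X])
    moreover have "AE x in M. T (\<lambda>y. \<Sum>i\<le>k. ?g i y) x = (\<Sum>i\<le>k. T (?g i) x)"
      by (rule ds_sum[OF T _ g]) simp
    ultimately show ?case
    proof eventually_elim
      case (elim x)
      have "T (r k) x = d (Suc k) x + r (Suc k) x"
        by (simp add: r_def u_Suc)
      with elim show ?case
        by (simp add: sum.atMost_Suc_shift del: sum.atMost_Suc)
    qed
  qed (simp add: r_def u_0)

  have d_sum_le: "\<bar>\<Sum>j<m. d j x\<bar> \<le> a" for m x
  proof -
    have "v m x = (\<Sum>j<m. \<bar>d j x\<bar>)"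
      by (induction m) (simp_all add: v_0 v_Suc)
    then show ?thesis
      using v_le[of m x] by (metis sum_abs order_trans)
  qed
  have kept: "AE x in M. (T ^^ i) (\<lambda>y. \<Sum>j<m. d j y) x = (\<Sum>j<m. (T ^^ i) (d j) x)
      \<and> \<bar>(T ^^ i) (\<lambda>y. \<Sum>j<m. d j y) x\<bar> \<le> a" for i m
    by (intro AE_conjI ds_sum[OF pow] d_X ds_AE_bounded[OF pow])
       (use a in \<open>auto simp: d_sum_le\<close>)

  have "AE x in M. x \<notin> (\<Union>k. B k) \<longrightarrow> (\<forall>n. \<bar>ergodic_average T n f x\<bar> \<le> a)"
  proof -
    have "AE x in M. \<forall>k. (T ^^ k) f x = (\<Sum>i\<le>k. (T ^^ i) (d (k - i)) x) + r k x"
      unfolding AE_all_countable by (intro allI decomp)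
    moreover have "AE x in M. \<forall>i m. (T ^^ i) (\<lambda>y. \<Sum>j<m. d j y) x = (\<Sum>j<m. (T ^^ i) (d j) x)
      \<and> \<bar>(T ^^ i) (\<lambda>y. \<Sum>j<m. d j y) x\<bar> \<le> a"
      unfolding AE_all_countable by (intro allI kept)
    ultimately show ?thesis
      using AE_space
    proof eventually_elim
      case (elim x)
      show ?case
      proof (intro impI allI)
        fix n assume x: "x \<notin> (\<Union>k. B k)"
        have "r k x = 0" for k
          using full[of k x] x elim(3) by (auto simp: B_def)
        then have "(\<Sum>k<n. (T ^^ k) f x) = (\<Sum>k<n. \<Sum>i\<le>k. (T ^^ i) (d (k - i)) x)"
          using elim(1) by simp
        also have "\<dots> = (\<Sum>i<n. \<Sum>j<n - i. (T ^^ i) (d j) x)"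
          by (rule sum_triangle_swap)
        also have "\<dots> = (\<Sum>i<n. (T ^^ i) (\<lambda>y. \<Sum>j<n - i. d j y) x)"
          using elim(2) by simp
        also have "\<bar>\<dots>\<bar> \<le> (\<Sum>i<n. a)"
          by (rule order_trans[OF sum_abs sum_mono]) (use elim(2) in blast)
        finally show "\<bar>ergodic_average T n f x\<bar> \<le> a"
          using a by (cases "n = 0") (simp_all add: ergodic_average_def abs_mult field_simps)
      qed
    qed
  qed
  moreover have "ennreal a * emeasure M (\<Union>k. B k) \<le> (\<integral>\<^sup>+x. ennreal \<bar>f x\<bar> \<partial>M)"
  proof -
    have "emeasure M (\<Union>k. B k) = (SUP k. emeasure M (B k))"
      using \<open>incseq B\<close> by (intro SUP_emeasure_incseq[symmetric]) auto
    then have "ennreal a * emeasure M (\<Union>k. B k) = (SUP k. ennreal a * emeasure M (B k))"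
      by (simp add: SUP_mult_left_ennreal)
    also have "\<dots> \<le> (\<integral>\<^sup>+x. ennreal \<bar>f x\<bar> \<partial>M)"
      by (rule SUP_least) (rule B_le)
    finally show ?thesis .
  qed
  ultimately show thesis
    by (intro that[of "\<Union>k. B k"]) auto
qed

lemma excess_le_square: "0 < c \<Longrightarrow> \<bar>a\<bar> - c \<le> a\<^sup>2 / (4 * c)" for a c :: real
proof -
  assume "0 < c"
  moreover have "0 \<le> (\<bar>a\<bar> - 2 * c)\<^sup>2" by simp
  ultimately show ?thesis by (simp add: field_simps power2_eq_square)
qed

text \<open>The weak type (2,2) inequality: the part of \<open>f\<close> below \<open>c\<close> contributes at most \<open>c\<close> to the averages,
  and the part above has \<open>L\<^sup>1\<close> norm at most \<open>\<integral> f\<^sup>2 / (4 c)\<close>.\<close>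

lemma maximal_inequality_L2:
  assumes T: "dunford_schwartz M T" and f: "f \<in> L1_plus_Linf M" and c: "0 < c"
    and fin: "(\<integral>\<^sup>+x. ennreal ((f x)\<^sup>2) \<partial>M) < \<infinity>"
  obtains B where "B \<in> sets M"
    and "ennreal (4 * c\<^sup>2) * emeasure M B \<le> (\<integral>\<^sup>+x. ennreal ((f x)\<^sup>2) \<partial>M)"
    and "AE x in M. x \<notin> B \<longrightarrow> (\<forall>n. \<bar>ergodic_average T n f x\<bar> \<le> 2 * c)"
proof -
  have [measurable]: "f \<in> borel_measurable M"
    using f by (rule L1_plus_Linf_measurable)
  have c0: "0 \<le> c" using c by simp
  let ?b = "\<lambda>x. clip c (f x)" and ?r = "\<lambda>x. f x - clip c (f x)"
  have excess: "ennreal (\<bar>f x\<bar> - c) \<le> ennreal (1 / (4 * c)) * ennreal ((f x)\<^sup>2)" for x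
  proof -
    have "ennreal (\<bar>f x\<bar> - c) \<le> ennreal (1 / (4 * c) * (f x)\<^sup>2)"
      using excess_le_square[OF c, of "f x"] by (intro ennreal_leI) simp
    then show ?thesis
      using c0 by (simp add: ennreal_mult del: times_divide_eq_left)
  qed
  have r_le: "(\<integral>\<^sup>+x. ennreal \<bar>?r x\<bar> \<partial>M) \<le> ennreal (1 / (4 * c)) * (\<integral>\<^sup>+x. ennreal ((f x)\<^sup>2) \<partial>M)"
  proof -
    have "(\<integral>\<^sup>+x. ennreal \<bar>?r x\<bar> \<partial>M) \<le> (\<integral>\<^sup>+x. ennreal (1 / (4 * c)) * ennreal ((f x)\<^sup>2) \<partial>M)"
      by (intro nn_integral_mono) (simp only: ennreal_abs_diff_clip[OF c0] excess)
    then show ?thesis by (simp add: nn_integral_cmult)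
  qed
  also have "\<dots> < \<infinity>"
    using fin by (simp add: ennreal_mult_less_top)
  finally have r: "?r \<in> L1 M"
    by (simp add: L1_iff)
  have b: "?b \<in> L1_plus_Linf M"
    by (rule bounded_in_L1_plus_Linf[where c = c]) (auto simp: abs_clip_le[OF c0])
  obtain B where B: "B \<in> sets M" "ennreal c * emeasure M B \<le> (\<integral>\<^sup>+x. ennreal \<bar>?r x\<bar> \<partial>M)"
    "AE x in M. x \<notin> B \<longrightarrow> (\<forall>n. \<bar>ergodic_average T n ?r x\<bar> \<le> c)"
    using maximal_inequality[OF T r c] .
  show thesis
  proof
    show "B \<in> sets M" by fact
    have "AE x in M. \<forall>n. ergodic_average T n (\<lambda>y. ?b y + ?r y) x
        = ergodic_average T n ?b x + ergodic_average T n ?r x"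
      unfolding AE_all_countable
      by (intro allI ds_add[OF ds_ergodic_average[OF T]] b L1_subset[OF r])
    moreover have "AE x in M. \<forall>n. \<bar>ergodic_average T n ?b x\<bar> \<le> c"
      unfolding AE_all_countable
      by (intro allI ds_AE_bounded[OF ds_ergodic_average[OF T]])
         (auto simp: abs_clip_le[OF c0] c0)
    ultimately show "AE x in M. x \<notin> B \<longrightarrow> (\<forall>n. \<bar>ergodic_average T n f x\<bar> \<le> 2 * c)"
      using B(3)
    proof eventually_elim
      case (elim x)
      show ?case
      proof (intro impI allI)
        fix n assume "x \<notin> B"
        then have "\<bar>ergodic_average T n ?r x\<bar> \<le> c" using elim(3) by blast
        moreover have "\<bar>ergodic_average T n ?b x\<bar> \<le> c" using elim(2) by blast
        moreover have "ergodic_average T n f x = ergodic_average T n ?b x + ergodic_average T n ?r x"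
          using elim(1) by simp
        ultimately show "\<bar>ergodic_average T n f x\<bar> \<le> 2 * c" by linarith
      qed
    qed
    have "ennreal (4 * c\<^sup>2) * emeasure M B = ennreal (4 * c) * (ennreal c * emeasure M B)"
      using c by (simp add: mult.assoc[symmetric] ennreal_mult'[symmetric] power2_eq_square)
    also have "\<dots> \<le> ennreal (4 * c) * (ennreal (1 / (4 * c)) * (\<integral>\<^sup>+x. ennreal ((f x)\<^sup>2) \<partial>M))"
      by (intro mult_left_mono order_trans[OF B(2) r_le]) simp
    also have "\<dots> = (\<integral>\<^sup>+x. ennreal ((f x)\<^sup>2) \<partial>M)"
      using c by (simp add: mult.assoc[symmetric] ennreal_mult'[symmetric])
    finally show "ennreal (4 * c\<^sup>2) * emeasure M B \<le> (\<integral>\<^sup>+x. ennreal ((f x)\<^sup>2) \<partial>M)" .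
  qed
qed

section \<open>The mean ergodic theorem\<close>

definition L2 :: "'a measure \<Rightarrow> ('a \<Rightarrow> real) set" where
  "L2 M = {f \<in> borel_measurable M. integrable M (\<lambda>x. (f x)\<^sup>2)}"

lemma L2_iff: "f \<in> L2 M \<longleftrightarrow> f \<in> borel_measurable M \<and> (\<integral>\<^sup>+x. ennreal ((f x)\<^sup>2) \<partial>M) < \<infinity>"
  by (auto simp: L2_def integrable_iff_bounded)

lemma nn_integral_square: "f \<in> L2 M \<Longrightarrow> (\<integral>\<^sup>+x. ennreal ((f x)\<^sup>2) \<partial>M) = ennreal (\<integral>x. (f x)\<^sup>2 \<partial>M)"
  by (rule nn_integral_eq_integral) (auto simp: L2_def)

lemma L2_subset:
  assumes "f \<in> L2 M"
  shows "f \<in> L1_plus_Linf M"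
proof -
  have f: "f \<in> borel_measurable M" and fin: "(\<integral>\<^sup>+x. ennreal ((f x)\<^sup>2) \<partial>M) < \<infinity>"
    using assms by (auto simp: L2_iff)
  have "\<bar>a\<bar> - 1 \<le> a\<^sup>2" for a :: real
    using excess_le_square[of 1 a] by simp (smt (verit) zero_le_power2)
  then have "(\<integral>\<^sup>+x. ennreal (\<bar>f x\<bar> - 1) \<partial>M) \<le> (\<integral>\<^sup>+x. ennreal ((f x)\<^sup>2) \<partial>M)"
    by (intro nn_integral_mono ennreal_leI)
  then show ?thesis
    using f fin by (auto simp: L1_plus_Linf_iff intro!: exI[of _ 1])
qed

lemma L2_cmult: "f \<in> L2 M \<Longrightarrow> (\<lambda>x. c * f x) \<in> L2 M"
  by (auto simp: L2_def power_mult_distrib)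

lemma L2_add:
  assumes "f \<in> L2 M" "g \<in> L2 M"
  shows "(\<lambda>x. f x + g x) \<in> L2 M"
proof -
  have [measurable]: "f \<in> borel_measurable M" "g \<in> borel_measurable M"
    and int: "integrable M (\<lambda>x. (f x)\<^sup>2)" "integrable M (\<lambda>x. (g x)\<^sup>2)"
    using assms by (auto simp: L2_def)
  have le: "(a + b)\<^sup>2 \<le> 2 * a\<^sup>2 + 2 * b\<^sup>2" for a b :: real
    using zero_le_power2[of "a - b"] by (simp add: power2_eq_square algebra_simps)
  have "integrable M (\<lambda>x. (f x + g x)\<^sup>2)"
    by (rule Bochner_Integration.integrable_bound[where f = "\<lambda>x. 2 * (f x)\<^sup>2 + 2 * (g x)\<^sup>2"])
       (auto simp: int le)
  then show ?thesis by (simp add: L2_def)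
qed

lemma L2_diff: "f \<in> L2 M \<Longrightarrow> g \<in> L2 M \<Longrightarrow> (\<lambda>x. f x - g x) \<in> L2 M"
  using L2_add[of f M "\<lambda>x. - 1 * g x"] L2_cmult[of g M "- 1"] by simp

lemma L2_sum:
  "(\<And>i. i \<in> I \<Longrightarrow> f i \<in> L2 M) \<Longrightarrow> (\<lambda>x. \<Sum>i\<in>I. f i x) \<in> L2 M"
proof (induction I rule: infinite_finite_induct)
  case (insert i I)
  then show ?case by (simp add: L2_add)
qed (simp_all add: L2_def)

lemma L2_parallelogram:
  assumes "f \<in> L2 M" "g \<in> L2 M"
  shows "(\<integral>x. (f x + g x)\<^sup>2 \<partial>M) + (\<integral>x. (f x - g x)\<^sup>2 \<partial>M)
       = 2 * (\<integral>x. (f x)\<^sup>2 \<partial>M) + 2 * (\<integral>x. (g x)\<^sup>2 \<partial>M)"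
proof -
  have int: "integrable M (\<lambda>x. (f x)\<^sup>2)" "integrable M (\<lambda>x. (g x)\<^sup>2)"
    "integrable M (\<lambda>x. (f x + g x)\<^sup>2)" "integrable M (\<lambda>x. (f x - g x)\<^sup>2)"
    using assms L2_add[OF assms] L2_diff[OF assms] by (auto simp: L2_def)
  have "(\<integral>x. (f x + g x)\<^sup>2 \<partial>M) + (\<integral>x. (f x - g x)\<^sup>2 \<partial>M)
      = (\<integral>x. (f x + g x)\<^sup>2 + (f x - g x)\<^sup>2 \<partial>M)"
    by (rule Bochner_Integration.integral_add[symmetric]) (fact int)+
  also have "\<dots> = (\<integral>x. 2 * (f x)\<^sup>2 + 2 * (g x)\<^sup>2 \<partial>M)"
    by (rule arg_cong[where f = "integral\<^sup>L M"]) (simp add: fun_eq_iff power2_eq_square algebra_simps)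
  also have "\<dots> = 2 * (\<integral>x. (f x)\<^sup>2 \<partial>M) + 2 * (\<integral>x. (g x)\<^sup>2 \<partial>M)"
    by (simp add: int)
  finally show ?thesis .
qed

text \<open>With small \<open>d\<close> this serves as a triangle inequality for squared norms when \<open>g\<close> is small.\<close>

lemma L2_add_le:
  assumes "f \<in> L2 M" "g \<in> L2 M" "0 < d"
  shows "(\<integral>x. (f x + g x)\<^sup>2 \<partial>M) \<le> (1 + d) * (\<integral>x. (f x)\<^sup>2 \<partial>M) + (1 + 1 / d) * (\<integral>x. (g x)\<^sup>2 \<partial>M)"
proof -
  have int: "integrable M (\<lambda>x. (f x)\<^sup>2)" "integrable M (\<lambda>x. (g x)\<^sup>2)"
    "integrable M (\<lambda>x. (f x + g x)\<^sup>2)"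
    using assms L2_add[OF assms(1,2)] by (auto simp: L2_def)
  have le: "(a + b)\<^sup>2 \<le> (1 + d) * a\<^sup>2 + (1 + 1 / d) * b\<^sup>2" for a b :: real
  proof -
    have "0 \<le> (d * a - b)\<^sup>2 / d" using assms(3) by simp
    also have "\<dots> = (1 + d) * a\<^sup>2 + (1 + 1 / d) * b\<^sup>2 - (a + b)\<^sup>2"
      using assms(3) by (simp add: field_simps power2_eq_square)
    finally show ?thesis by simp
  qed
  have "(\<integral>x. (f x + g x)\<^sup>2 \<partial>M) \<le> (\<integral>x. (1 + d) * (f x)\<^sup>2 + (1 + 1 / d) * (g x)\<^sup>2 \<partial>M)"
    by (rule integral_mono) (auto simp: int le)
  also have "\<dots> = (1 + d) * (\<integral>x. (f x)\<^sup>2 \<partial>M) + (1 + 1 / d) * (\<integral>x. (g x)\<^sup>2 \<partial>M)"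
    by (simp add: int)
  finally show ?thesis .
qed

lemma ds_L2:
  assumes M: "sigma_finite_measure M" and T: "dunford_schwartz M T" and f: "f \<in> L2 M"
  shows "T f \<in> L2 M" and "(\<integral>x. (T f x)\<^sup>2 \<partial>M) \<le> (\<integral>x. (f x)\<^sup>2 \<partial>M)"
proof -
  have le: "(\<integral>\<^sup>+x. ennreal ((T f x)\<^sup>2) \<partial>M) \<le> (\<integral>\<^sup>+x. ennreal ((f x)\<^sup>2) \<partial>M)"
    by (rule ds_L2_contraction[OF M T L2_subset[OF f]])
  also have "\<dots> < \<infinity>"
    using f by (simp add: L2_iff)
  finally show Tf: "T f \<in> L2 M"
    using ds_measurable[OF T L2_subset[OF f]] by (simp add: L2_iff)
  show "(\<integral>x. (T f x)\<^sup>2 \<partial>M) \<le> (\<integral>x. (f x)\<^sup>2 \<partial>M)"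
    using le by (simp add: nn_integral_square f Tf)
qed

definition partial_sums_mean :: "(('a \<Rightarrow> real) \<Rightarrow> 'a \<Rightarrow> real) \<Rightarrow> nat \<Rightarrow> ('a \<Rightarrow> real) \<Rightarrow> 'a \<Rightarrow> real" where
  "partial_sums_mean T m f x = (1 / real m) * (\<Sum>k<m. \<Sum>j<k. (T ^^ j) f x)"

lemma partial_sums_mean_L1_plus_Linf:
  "dunford_schwartz M T \<Longrightarrow> f \<in> L1_plus_Linf M \<Longrightarrow> partial_sums_mean T m f \<in> L1_plus_Linf M"
  unfolding partial_sums_mean_def[abs_def]
  by (intro L1_plus_Linf_cmult L1_plus_Linf_sum) (rule ds_L1_plus_Linf[OF ds_funpow])

lemma partial_sums_mean_L2:
  "sigma_finite_measure M \<Longrightarrow> dunford_schwartz M T \<Longrightarrow> f \<in> L2 M \<Longrightarrow> partial_sums_mean T m f \<in> L2 M"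
  unfolding partial_sums_mean_def[abs_def]
  by (intro L2_cmult L2_sum) (rule ds_L2(1)[OF _ ds_funpow])

lemma partial_sums_mean_bounded:
  assumes T: "dunford_schwartz M T" and f: "f \<in> borel_measurable M"
    and c: "0 \<le> c" "AE x in M. \<bar>f x\<bar> \<le> c"
  shows "AE x in M. \<bar>partial_sums_mean T m f x\<bar> \<le> real m * c"
proof -
  have "AE x in M. \<forall>k. \<bar>(T ^^ k) f x\<bar> \<le> c"
    unfolding AE_all_countable by (intro allI ds_AE_bounded[OF ds_funpow[OF T] f c])
  then show ?thesis
  proof eventually_elim
    case (elim x)
    have "\<bar>\<Sum>j<k. (T ^^ j) f x\<bar> \<le> real m * c" if "k < m" for k
    proof -
      have "\<bar>\<Sum>j<k. (T ^^ j) f x\<bar> \<le> (\<Sum>j<k. c)"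
        by (rule order_trans[OF sum_abs sum_mono]) (use elim in simp)
      also have "\<dots> \<le> real m * c"
        using that c by (simp add: mult_right_mono)
      finally show ?thesis .
    qed
    then have "\<bar>\<Sum>k<m. \<Sum>j<k. (T ^^ j) f x\<bar> \<le> (\<Sum>k<m. real m * c)"
      by (intro order_trans[OF sum_abs sum_mono]) simp
    then show ?case
      using c by (cases "m = 0") (simp_all add: partial_sums_mean_def abs_mult field_simps)
  qed
qed

text \<open>The function \<open>f - A\<^sub>m f\<close> is a coboundary \<open>h - T h\<close>, where \<open>h\<close> is the mean of the first
  partial sums of the orbit; on a coboundary the averages telescope. This makes \<open>A\<^sub>N f\<close> and
  \<open>A\<^sub>N (A\<^sub>m f)\<close> asymptotically equal, both in \<open>L\<^sup>2\<close> and uniformly.\<close>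

lemma average_minus_average_of_average:
  assumes T: "dunford_schwartz M T" and f: "f \<in> L1_plus_Linf M" and m: "0 < m"
  defines "h \<equiv> partial_sums_mean T m f"
  shows "AE x in M. \<forall>N. ergodic_average T N f x - ergodic_average T N (ergodic_average T m f) x
           = (1 / real N) * (h x - (T ^^ N) h x)"
proof -
  note pow = ds_funpow[OF T] and avg = ds_ergodic_average[OF T]
  have T_f: "(T ^^ k) f \<in> L1_plus_Linf M" for k
    by (rule ds_L1_plus_Linf[OF pow f])
  have h: "h \<in> L1_plus_Linf M"
    unfolding h_def by (rule partial_sums_mean_L1_plus_Linf[OF T f])
  have Th: "T h \<in> L1_plus_Linf M"
    by (rule ds_L1_plus_Linf[OF T h])
  have cobound: "AE x in M. f x - ergodic_average T m f x = h x - T h x"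
  proof -
    let ?s = "\<lambda>k x. \<Sum>j<k. (T ^^ j) f x"
    have s: "?s k \<in> L1_plus_Linf M" for k
      by (intro L1_plus_Linf_sum T_f)
    have "AE x in M. T h x = (1 / real m) * T (\<lambda>y. \<Sum>k<m. ?s k y) x"
      unfolding h_def partial_sums_mean_def[abs_def] by (intro ds_cmult[OF T] L1_plus_Linf_sum s)
    moreover have "AE x in M. T (\<lambda>y. \<Sum>k<m. ?s k y) x = (\<Sum>k<m. T (?s k) x)"
      by (rule ds_sum[OF T _ s]) simp
    moreover have "AE x in M. \<forall>k. T (?s k) x = (\<Sum>j<k. T ((T ^^ j) f) x)"
      unfolding AE_all_countable by (intro allI ds_sum[OF T _ T_f]) simp
    ultimately show ?thesis
    proof eventually_elim
      case (elim x)
      have telescope: "(\<Sum>j<k. (T ^^ j) f x) - (\<Sum>j<k. (T ^^ Suc j) f x) = f x - (T ^^ k) f x" for k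
        by (induction k) simp_all
      have "h x - T h x = (1 / real m) * (\<Sum>k<m. (\<Sum>j<k. (T ^^ j) f x) - (\<Sum>j<k. (T ^^ Suc j) f x))"
        using elim by (simp add: h_def partial_sums_mean_def right_diff_distrib sum_subtractf)
      also have "\<dots> = (1 / real m) * (\<Sum>k<m. f x - (T ^^ k) f x)"
        by (simp only: telescope)
      also have "\<dots> = f x - ergodic_average T m f x"
        using m by (simp add: ergodic_average_def sum_subtractf right_diff_distrib)
      finally show ?case by simp
    qed
  qed
  have "AE x in M. ergodic_average T N f x - ergodic_average T N (ergodic_average T m f) x
           = (1 / real N) * (h x - (T ^^ N) h x)" for N
  proof -
    note Af = ds_L1_plus_Linf[OF avg f, of m]
    have "AE x in M. ergodic_average T N (\<lambda>y. f y - ergodic_average T m f y) x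
        = ergodic_average T N f x - ergodic_average T N (ergodic_average T m f) x"
      by (rule ds_diff[OF avg f Af])
    moreover have "AE x in M. ergodic_average T N (\<lambda>y. f y - ergodic_average T m f y) x
        = ergodic_average T N (\<lambda>y. h y - T h y) x"
      by (rule ds_cong[OF avg L1_plus_Linf_diff[OF f Af] L1_plus_Linf_diff[OF h Th] cobound])
    moreover have "AE x in M. \<forall>k. (T ^^ k) (\<lambda>y. h y - T h y) x = (T ^^ k) h x - (T ^^ k) (T h) x"
      unfolding AE_all_countable by (intro allI ds_diff[OF pow h Th])
    ultimately show ?thesis
    proof eventually_elim
      case (elim x)
      have "ergodic_average T N (\<lambda>y. h y - T h y) x
          = (1 / real N) * (\<Sum>k<N. (T ^^ k) h x - (T ^^ Suc k) h x)"
        using elim(3) by (simp add: ergodic_average_def funpow_swap1)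
      also have "\<dots> = (1 / real N) * (h x - (T ^^ N) h x)"
        by (subst sum_lessThan_telescope') simp
      finally show ?case
        using elim by simp
    qed
  qed
  then show ?thesis
    unfolding AE_all_countable by blast
qed

lemma L2_average_minus_average_of_average:
  assumes M: "sigma_finite_measure M" and T: "dunford_schwartz M T" and f: "f \<in> L2 M" and m: "0 < m"
  shows "(\<lambda>N. \<integral>x. (ergodic_average T N f x - ergodic_average T N (ergodic_average T m f) x)\<^sup>2 \<partial>M)
           \<longlonglongrightarrow> 0"
proof -
  define h where "h = partial_sums_mean T m f"
  have h: "h \<in> L2 M"
    unfolding h_def by (rule partial_sums_mean_L2[OF M T f])
  have le: "(\<integral>x. (ergodic_average T N f x - ergodic_average T N (ergodic_average T m f) x)\<^sup>2 \<partial>M)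
      \<le> 4 * (\<integral>x. (h x)\<^sup>2 \<partial>M) / (real N)\<^sup>2" for N
  proof -
    note Th = ds_L2[OF M ds_funpow[OF T] h, of N]
    have meas: "g \<in> borel_measurable M" if "g \<in> L2 M" for g :: "'a \<Rightarrow> real"
      using that by (simp add: L2_def)
    note A = ds_L2(1)[OF M ds_ergodic_average[OF T]]
    note [measurable] = meas[OF A[OF f, of N]] meas[OF A[OF A[OF f, of m], of N]] meas[OF h] meas[OF Th(1)]
    have "(\<integral>x. (ergodic_average T N f x - ergodic_average T N (ergodic_average T m f) x)\<^sup>2 \<partial>M)
        = (\<integral>x. (1 / (real N)\<^sup>2) * (h x - (T ^^ N) h x)\<^sup>2 \<partial>M)"
      by (rule integral_cong_AE, measurable)
         (use average_minus_average_of_average[OF T L2_subset[OF f] m] in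
           \<open>eventually_elim, simp add: h_def power_mult_distrib power_divide\<close>)
    also have "\<dots> = (1 / (real N)\<^sup>2) * (\<integral>x. (h x - (T ^^ N) h x)\<^sup>2 \<partial>M)"
      by simp
    also have "\<dots> \<le> (1 / (real N)\<^sup>2) * (4 * (\<integral>x. (h x)\<^sup>2 \<partial>M))"
    proof (rule mult_left_mono)
      have "0 \<le> (\<integral>x. (h x + (T ^^ N) h x)\<^sup>2 \<partial>M)" by simp
      then show "(\<integral>x. (h x - (T ^^ N) h x)\<^sup>2 \<partial>M) \<le> 4 * (\<integral>x. (h x)\<^sup>2 \<partial>M)"
        using L2_parallelogram[OF h Th(1)] Th(2) by linarith
    qed simp
    finally show ?thesis by simp
  qed
  have lim: "(\<lambda>N. 4 * (\<integral>x. (h x)\<^sup>2 \<partial>M) / (real N)\<^sup>2) \<longlonglongrightarrow> 0"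
    by (intro real_tendsto_divide_at_top[OF tendsto_const] filterlim_pow_at_top filterlim_real_sequentially) simp
  show ?thesis
    by (rule tendsto_sandwich[OF _ _ tendsto_const lim]) (auto intro!: always_eventually le)
qed

text \<open>If the averages of \<open>u\<close> and \<open>f\<close> are asymptotically equal, then \<open>u\<close> has at least the limiting
  norm of the averages of \<open>f\<close>. In particular this limit is the infimum of the norms
  of the averages, and midpoints of two averages do not fall below it either; by the parallelogram
  law the averages form a Cauchy sequence.\<close>

lemma L2_average_le:
  assumes M: "sigma_finite_measure M" and T: "dunford_schwartz M T" and f: "f \<in> L2 M" and u: "u \<in> L2 M"
    and lim: "(\<lambda>N. \<integral>x. (ergodic_average T N f x - ergodic_average T N u x)\<^sup>2 \<partial>M) \<longlonglongrightarrow> 0"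
    and e: "0 < e"
  shows "\<forall>\<^sub>F N in sequentially. (\<integral>x. (ergodic_average T N f x)\<^sup>2 \<partial>M) \<le> (\<integral>x. (u x)\<^sup>2 \<partial>M) + e"
proof -
  define q where "q = (\<integral>x. (u x)\<^sup>2 \<partial>M)"
  have q: "0 \<le> q" by (simp add: q_def)
  \<comment> \<open>The \<open>+ 1\<close> covers the case \<open>q = 0\<close>.\<close>
  define d where "d = e / (2 * (q + 1))"
  have d: "0 < d" "d * q \<le> e / 2"
    using e q by (auto simp: d_def field_simps)
  have "(\<lambda>N. (1 + 1 / d) * (\<integral>x. (ergodic_average T N f x - ergodic_average T N u x)\<^sup>2 \<partial>M)) \<longlonglongrightarrow> (1 + 1 / d) * 0"
    by (intro tendsto_mult tendsto_const lim)
  then have "\<forall>\<^sub>F N in sequentially.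
      (1 + 1 / d) * (\<integral>x. (ergodic_average T N f x - ergodic_average T N u x)\<^sup>2 \<partial>M) < e / 2"
    by (rule order_tendstoD) (use e in simp)
  then show ?thesis
  proof eventually_elim
    case (elim N)
    note A = ds_L2[OF M ds_ergodic_average[OF T, of N]]
    have "(\<integral>x. (ergodic_average T N f x)\<^sup>2 \<partial>M)
        = (\<integral>x. (ergodic_average T N u x + (ergodic_average T N f x - ergodic_average T N u x))\<^sup>2 \<partial>M)"
      by simp
    also have "\<dots> \<le> (1 + d) * (\<integral>x. (ergodic_average T N u x)\<^sup>2 \<partial>M)
        + (1 + 1 / d) * (\<integral>x. (ergodic_average T N f x - ergodic_average T N u x)\<^sup>2 \<partial>M)"
      by (rule L2_add_le[OF A(1)[OF u] L2_diff[OF A(1)[OF f] A(1)[OF u]] d(1)])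
    also have "\<dots> \<le> (1 + d) * q + e / 2"
      using elim A(2)[OF u] d by (intro add_mono mult_left_mono) (auto simp: q_def)
    also have "\<dots> \<le> q + e"
      using d by (simp add: algebra_simps)
    finally show ?case by (simp add: q_def)
  qed
qed

lemma L2_averages_Cauchy:
  assumes M: "sigma_finite_measure M" and T: "dunford_schwartz M T" and f: "f \<in> L2 M" and e: "0 < e"
  obtains K where "0 < K"
    and "\<And>m n. K \<le> m \<Longrightarrow> K \<le> n \<Longrightarrow>
           (\<integral>x. (ergodic_average T m f x - ergodic_average T n f x)\<^sup>2 \<partial>M) \<le> e"
proof -
  let ?A = "\<lambda>n. ergodic_average T n f"
  define Q where "Q g = (\<integral>x. (g x)\<^sup>2 \<partial>M)" for g :: "'a \<Rightarrow> real"
  have Q_nonneg: "0 \<le> Q g" for g by (simp add: Q_def)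
  define I where "I = (INF n\<in>{0<..}. Q (?A n))"
  have bdd: "bdd_below ((\<lambda>n. Q (?A n)) ` {0<..})"
    by (intro bdd_belowI2[of _ 0] Q_nonneg)
  have I_le_A: "I \<le> Q (?A n)" if "0 < n" for n
    unfolding I_def by (intro cINF_lower bdd) (use that in simp)
  note A = ds_L2(1)[OF M ds_ergodic_average[OF T]]
  have I_le: "I \<le> Q u" if u: "u \<in> L2 M"
    and lim: "(\<lambda>N. \<integral>x. (ergodic_average T N f x - ergodic_average T N u x)\<^sup>2 \<partial>M) \<longlonglongrightarrow> 0" for u
  proof (rule field_le_epsilon)
    fix d :: real assume "0 < d"
    have "\<forall>\<^sub>F N in sequentially. Q (?A N) \<le> Q u + d \<and> 0 < N"
      using L2_average_le[OF M T f u lim \<open>0 < d\<close>] eventually_gt_at_top[of 0]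
      unfolding Q_def by eventually_elim simp
    then obtain N where "Q (?A N) \<le> Q u + d" "0 < N"
      by (auto simp: eventually_sequentially)
    then show "I \<le> Q u + d"
      using I_le_A[of N] by linarith
  qed
  have "\<exists>n\<in>{0<..}. Q (?A n) < I + e / 8"
    unfolding I_def by (intro cINF_less_iff[THEN iffD1] bdd) (use e in \<open>auto simp: I_def\<close>)
  then obtain n0 where n0: "0 < n0" "Q (?A n0) < I + e / 8"
    by auto
  have "\<forall>\<^sub>F N in sequentially. Q (?A N) \<le> Q (?A n0) + e / 8"
    unfolding Q_def using e
    by (intro L2_average_le[OF M T f A[OF f]] L2_average_minus_average_of_average[OF M T f] n0) simp
  then obtain K where K: "\<And>N. K \<le> N \<Longrightarrow> Q (?A N) \<le> I + e / 4"
    using n0 by (force simp: eventually_sequentially)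
  show thesis
  proof
    show "0 < Suc K" by simp
    fix m n assume mn: "Suc K \<le> m" "Suc K \<le> n"
    define u where "u x = (1 / 2) * (?A m x + ?A n x)" for x
    have u: "u \<in> L2 M"
      unfolding u_def[abs_def] by (intro L2_cmult L2_add A f)
    have "I \<le> Q u"
    proof (rule I_le[OF u])
      let ?D = "\<lambda>i N x. ergodic_average T N f x - ergodic_average T N (?A i) x"
      have D: "?D i N \<in> L2 M" for i N
        by (intro L2_diff A f)
      have le: "(\<integral>x. (ergodic_average T N f x - ergodic_average T N u x)\<^sup>2 \<partial>M)
          \<le> (\<integral>x. (?D m N x)\<^sup>2 \<partial>M) / 2 + (\<integral>x. (?D n N x)\<^sup>2 \<partial>M) / 2" for N
      proof -
        note avg = ds_ergodic_average[OF T, of N]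
        note meas = L1_plus_Linf_measurable[OF L2_subset]
        note [measurable] = meas[OF A[OF f]] meas[OF A[OF u]] meas[OF D]
        have "AE x in M. ergodic_average T N u x = (1 / 2) * ergodic_average T N (\<lambda>y. ?A m y + ?A n y) x"
          unfolding u_def[abs_def] by (intro ds_cmult[OF avg] L2_subset L2_add A f)
        moreover have "AE x in M. ergodic_average T N (\<lambda>y. ?A m y + ?A n y) x
            = ergodic_average T N (?A m) x + ergodic_average T N (?A n) x"
          by (intro ds_add[OF avg] L2_subset A f)
        ultimately have "AE x in M. (ergodic_average T N f x - ergodic_average T N u x)\<^sup>2
            = (1 / 4) * (?D m N x + ?D n N x)\<^sup>2"
        proof eventually_elim
          case (elim x)
          then have "ergodic_average T N f x - ergodic_average T N u x = (1 / 2) * (?D m N x + ?D n N x)"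
            by simp
          then show ?case
            by (simp only: power_mult_distrib) (simp add: power2_eq_square)
        qed
        then have "(\<integral>x. (ergodic_average T N f x - ergodic_average T N u x)\<^sup>2 \<partial>M)
            = (\<integral>x. (1 / 4) * (?D m N x + ?D n N x)\<^sup>2 \<partial>M)"
          by (intro integral_cong_AE) measurable
        also have "\<dots> = (1 / 4) * (\<integral>x. (?D m N x + ?D n N x)\<^sup>2 \<partial>M)"
          by (rule integral_mult_right_zero)
        also have "\<dots> \<le> (\<integral>x. (?D m N x)\<^sup>2 \<partial>M) / 2 + (\<integral>x. (?D n N x)\<^sup>2 \<partial>M) / 2"
          using L2_add_le[OF D[of N m] D[of N n], of 1] by simp
        finally show ?thesis .
      qed
      have "(\<lambda>N. (\<integral>x. (?D m N x)\<^sup>2 \<partial>M) / 2 + (\<integral>x. (?D n N x)\<^sup>2 \<partial>M) / 2) \<longlonglongrightarrow> 0 / 2 + 0 / 2"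
        using mn by (intro tendsto_intros L2_average_minus_average_of_average[OF M T f]) auto
      then have lim: "(\<lambda>N. (\<integral>x. (?D m N x)\<^sup>2 \<partial>M) / 2 + (\<integral>x. (?D n N x)\<^sup>2 \<partial>M) / 2) \<longlonglongrightarrow> 0"
        by simp
      show "(\<lambda>N. \<integral>x. (ergodic_average T N f x - ergodic_average T N u x)\<^sup>2 \<partial>M) \<longlonglongrightarrow> 0"
        by (rule tendsto_sandwich[OF _ _ tendsto_const lim]) (auto intro!: always_eventually le)
    qed
    also have "Q u = (1 / 4) * (\<integral>x. (?A m x + ?A n x)\<^sup>2 \<partial>M)"
      unfolding Q_def u_def power_mult_distrib integral_mult_right_zero by (simp add: power2_eq_square)
    finally have "4 * I \<le> (\<integral>x. (?A m x + ?A n x)\<^sup>2 \<partial>M)" by simp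
    then show "(\<integral>x. (?A m x - ?A n x)\<^sup>2 \<partial>M) \<le> e"
      using L2_parallelogram[OF A[OF f, of m] A[OF f, of n]] K[of m] K[of n] mn
      unfolding Q_def by linarith
  qed
qed

section \<open>Convergence almost everywhere\<close>

lemma average_of_average:
  assumes T: "dunford_schwartz M T" and f: "f \<in> L1_plus_Linf M"
  shows "AE x in M. ergodic_average T n (ergodic_average T i f) x
           = (1 / real n) * ((1 / real i) * (\<Sum>k<n. \<Sum>j<i. (T ^^ (k + j)) f x))"
proof -
  note pow = ds_funpow[OF T]
  have T_f: "(T ^^ k) f \<in> L1_plus_Linf M" for k
    by (rule ds_L1_plus_Linf[OF pow f])
  have "AE x in M. \<forall>k. (T ^^ k) (ergodic_average T i f) x = (1 / real i) * (\<Sum>j<i. (T ^^ (k + j)) f x)"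
    unfolding AE_all_countable
  proof
    fix k
    have "AE x in M. (T ^^ k) (ergodic_average T i f) x = (1 / real i) * (T ^^ k) (\<lambda>y. \<Sum>j<i. (T ^^ j) f y) x"
      unfolding ergodic_average_def[abs_def] by (intro ds_cmult[OF pow] L1_plus_Linf_sum T_f)
    moreover have "AE x in M. (T ^^ k) (\<lambda>y. \<Sum>j<i. (T ^^ j) f y) x = (\<Sum>j<i. (T ^^ k) ((T ^^ j) f) x)"
      by (rule ds_sum[OF pow _ T_f]) simp
    ultimately show "AE x in M. (T ^^ k) (ergodic_average T i f) x = (1 / real i) * (\<Sum>j<i. (T ^^ (k + j)) f x)"
      by eventually_elim (simp add: funpow_add)
  qed
  then show ?thesis
    by eventually_elim (simp add: ergodic_average_def sum_distrib_left)
qed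

lemma averages_commute:
  assumes T: "dunford_schwartz M T" and f: "f \<in> L1_plus_Linf M"
  shows "AE x in M. ergodic_average T n (ergodic_average T i f) x
           = ergodic_average T i (ergodic_average T n f) x"
  using average_of_average[OF T f, of n i] average_of_average[OF T f, of i n]
proof eventually_elim
  case (elim x)
  have "(\<Sum>k<n. \<Sum>j<i. (T ^^ (k + j)) f x) = (\<Sum>k<i. \<Sum>j<n. (T ^^ (k + j)) f x)"
    by (subst sum.swap) (simp add: add.commute)
  with elim show ?case by (simp add: mult_ac)
qed

text \<open>Convergence up to small oscillation and off small sets: this form passes to limits of
  functions under the maximal inequality, and it implies convergence almost everywhere.\<close>

definition nearly_convergent :: "'a measure \<Rightarrow> (('a \<Rightarrow> real) \<Rightarrow> 'a \<Rightarrow> real) \<Rightarrow> ('a \<Rightarrow> real) \<Rightarrow> bool" where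
  "nearly_convergent M T f \<longleftrightarrow>
     (\<forall>e>0. \<forall>d>0. \<exists>B\<in>sets M. emeasure M B \<le> ennreal d \<and>
        (AE x in M. x \<notin> B \<longrightarrow>
           (\<exists>K. \<forall>m\<ge>K. \<forall>n\<ge>K. \<bar>ergodic_average T m f x - ergodic_average T n f x\<bar> \<le> e)))"

lemma nearly_convergent_AE_convergent:
  assumes "nearly_convergent M T f"
  shows "AE x in M. convergent (\<lambda>n. ergodic_average T n f x)"
proof -
  define small where "small j i B \<longleftrightarrow> B \<in> sets M \<and> emeasure M B \<le> ennreal (1 / real (Suc i)) \<and>
      (AE x in M. x \<notin> B \<longrightarrow> (\<exists>K. \<forall>m\<ge>K. \<forall>n\<ge>K.
         \<bar>ergodic_average T m f x - ergodic_average T n f x\<bar> \<le> 1 / real (Suc j)))"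
    for j i :: nat and B
  have "\<exists>B. small j i B" for j i
  proof -
    have "0 < 1 / real (Suc j)" "0 < 1 / real (Suc i)" by simp_all
    from assms[unfolded nearly_convergent_def, rule_format, OF this] show ?thesis
      unfolding small_def by blast
  qed
  then obtain B where "\<And>j i. small j i (B j i)"
    by metis
  then have B: "\<And>j i. B j i \<in> sets M" "\<And>j i. emeasure M (B j i) \<le> ennreal (1 / real (Suc i))"
    "\<And>j i. AE x in M. x \<notin> B j i \<longrightarrow> (\<exists>K. \<forall>m\<ge>K. \<forall>n\<ge>K.
           \<bar>ergodic_average T m f x - ergodic_average T n f x\<bar> \<le> 1 / real (Suc j))"
    unfolding small_def by blast+
  have null: "AE x in M. x \<notin> (\<Inter>i. B j i)" for j
  proof (rule AE_not_in, rule null_setsI)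
    show "(\<Inter>i. B j i) \<in> sets M" using B(1) by auto
    have "emeasure M (\<Inter>i. B j i) \<le> ennreal (1 / real (Suc i))" for i
      by (rule order_trans[OF emeasure_mono B(2)]) (use B(1) in auto)
    moreover have "(\<lambda>i. ennreal (1 / real (Suc i))) \<longlonglongrightarrow> ennreal 0"
      by (rule tendsto_ennrealI) (simp only: lim_1_over_n[THEN LIMSEQ_Suc])
    ultimately have "emeasure M (\<Inter>i. B j i) \<le> ennreal 0"
      by (intro LIMSEQ_le_const) auto
    then show "emeasure M (\<Inter>i. B j i) = 0" by simp
  qed
  have "AE x in M. \<forall>j. x \<notin> (\<Inter>i. B j i)"
    unfolding AE_all_countable by (intro allI null)
  moreover have "AE x in M. \<forall>j i. x \<notin> B j i \<longrightarrow> (\<exists>K. \<forall>m\<ge>K. \<forall>n\<ge>K.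
           \<bar>ergodic_average T m f x - ergodic_average T n f x\<bar> \<le> 1 / real (Suc j))"
    unfolding AE_all_countable by (intro allI B(3))
  ultimately show ?thesis
  proof eventually_elim
    case (elim x)
    have "Cauchy (\<lambda>n. ergodic_average T n f x)"
    proof (rule CauchyI)
      fix e :: real assume "0 < e"
      then obtain j where j: "1 / real (Suc j) < e"
        using reals_Archimedean by (auto simp: inverse_eq_divide)
      obtain i where "x \<notin> B j i" using elim(1) by blast
      then obtain K where "\<forall>m\<ge>K. \<forall>n\<ge>K.
           \<bar>ergodic_average T m f x - ergodic_average T n f x\<bar> \<le> 1 / real (Suc j)"
        using elim(2) by blast
      then show "\<exists>K. \<forall>m\<ge>K. \<forall>n\<ge>K. norm (ergodic_average T m f x - ergodic_average T n f x) < e"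
        using j by (intro exI[of _ K]) (auto intro: le_less_trans)
    qed
    then show ?case by (rule Cauchy_convergent)
  qed
qed

lemma nearly_convergent_approx:
  assumes approx: "\<And>e d. 0 < e \<Longrightarrow> 0 < d \<Longrightarrow> \<exists>g. nearly_convergent M T g \<and>
      (\<exists>B\<in>sets M. emeasure M B \<le> ennreal d \<and>
        (AE x in M. x \<notin> B \<longrightarrow> (\<forall>n. \<bar>ergodic_average T n f x - ergodic_average T n g x\<bar> \<le> e)))"
  shows "nearly_convergent M T f"
  unfolding nearly_convergent_def
proof (intro allI impI)
  fix e d :: real assume "0 < e" "0 < d"
  then have pos: "0 < e / 3" "0 < d / 2" by simp_all
  obtain g B where g: "nearly_convergent M T g" and B: "B \<in> sets M" "emeasure M B \<le> ennreal (d / 2)"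
    and le: "AE x in M. x \<notin> B \<longrightarrow> (\<forall>n. \<bar>ergodic_average T n f x - ergodic_average T n g x\<bar> \<le> e / 3)"
    using approx[OF pos] by blast
  obtain C where C: "C \<in> sets M" "emeasure M C \<le> ennreal (d / 2)"
    and osc: "AE x in M. x \<notin> C \<longrightarrow>
      (\<exists>K. \<forall>m\<ge>K. \<forall>n\<ge>K. \<bar>ergodic_average T m g x - ergodic_average T n g x\<bar> \<le> e / 3)"
    using g[unfolded nearly_convergent_def, rule_format, OF pos] by blast
  show "\<exists>B\<in>sets M. emeasure M B \<le> ennreal d \<and>
        (AE x in M. x \<notin> B \<longrightarrow>
           (\<exists>K. \<forall>m\<ge>K. \<forall>n\<ge>K. \<bar>ergodic_average T m f x - ergodic_average T n f x\<bar> \<le> e))"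
  proof (intro bexI[of _ "B \<union> C"] conjI)
    have "emeasure M (B \<union> C) \<le> ennreal (d / 2) + ennreal (d / 2)"
      by (rule order_trans[OF emeasure_subadditive add_mono]) (use B C in auto)
    also have "\<dots> = ennreal d"
      using \<open>0 < d\<close> by (subst ennreal_plus[symmetric]) auto
    finally show "emeasure M (B \<union> C) \<le> ennreal d" .
    show "AE x in M. x \<notin> B \<union> C \<longrightarrow>
           (\<exists>K. \<forall>m\<ge>K. \<forall>n\<ge>K. \<bar>ergodic_average T m f x - ergodic_average T n f x\<bar> \<le> e)"
      using le osc
    proof eventually_elim
      case (elim x)
      show ?case
      proof
        assume x: "x \<notin> B \<union> C"
        then obtain K where K: "\<And>m n. K \<le> m \<Longrightarrow> K \<le> n \<Longrightarrow>
            \<bar>ergodic_average T m g x - ergodic_average T n g x\<bar> \<le> e / 3"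
          using elim(2) by auto
        have fg: "\<bar>ergodic_average T n f x - ergodic_average T n g x\<bar> \<le> e / 3" for n
          using elim(1) x by blast
        have "\<bar>ergodic_average T m f x - ergodic_average T n f x\<bar> \<le> e" if "K \<le> m" "K \<le> n" for m n
          using K[OF that] fg[of m] fg[of n] by linarith
        then show "\<exists>K. \<forall>m\<ge>K. \<forall>n\<ge>K. \<bar>ergodic_average T m f x - ergodic_average T n f x\<bar> \<le> e"
          by blast
      qed
    qed
  qed (use B C in auto)
qed

lemma L1_bounded_in_L2:
  assumes f: "f \<in> L1 M" and c: "AE x in M. \<bar>f x\<bar> \<le> c"
  shows "f \<in> L2 M"
proof -
  have [measurable]: "f \<in> borel_measurable M" using f by (simp add: L1_iff)
  have "integrable M (\<lambda>x. c * \<bar>f x\<bar>)" using f by (simp add: L1_def)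
  then have "integrable M (\<lambda>x. (f x)\<^sup>2)"
  proof (rule Bochner_Integration.integrable_bound)
    show "AE x in M. norm ((f x)\<^sup>2) \<le> norm (c * \<bar>f x\<bar>)"
      using c
    proof eventually_elim
      case (elim x)
      then have "\<bar>f x\<bar> * \<bar>f x\<bar> \<le> c * \<bar>f x\<bar>" by (intro mult_right_mono) auto
      then show ?case by (simp add: power2_eq_square)
    qed
  qed simp
  then show ?thesis by (simp add: L2_def)
qed

text \<open>Read with \<open>N\<close> large and \<open>m\<close> fixed, the averages of \<open>f\<close> and \<open>A\<^sub>m f\<close> are asymptotically equal;
  since averages commute, it also says that \<open>A\<^sub>N f\<close> is almost fixed by \<open>A\<^sub>m\<close>.\<close>

lemma bounded_averages_almost_fixed:
  assumes T: "dunford_schwartz M T" and f: "f \<in> borel_measurable M"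
    and c: "0 \<le> c" "AE x in M. \<bar>f x\<bar> \<le> c" and m: "0 < m"
  shows "AE x in M. \<forall>N. \<bar>ergodic_average T N f x - ergodic_average T N (ergodic_average T m f) x\<bar>
           \<le> 2 * real m * c / real N"
proof -
  define h where "h = partial_sums_mean T m f"
  have f_X: "f \<in> L1_plus_Linf M"
    using f c(2) by (rule bounded_in_L1_plus_Linf)
  have h_X: "h \<in> L1_plus_Linf M"
    unfolding h_def by (rule partial_sums_mean_L1_plus_Linf[OF T f_X])
  have h_le: "AE x in M. \<bar>h x\<bar> \<le> real m * c"
    unfolding h_def by (rule partial_sums_mean_bounded[OF T f c])
  have "AE x in M. \<forall>N. \<bar>(T ^^ N) h x\<bar> \<le> real m * c"
    unfolding AE_all_countable
    by (intro allI ds_AE_bounded[OF ds_funpow[OF T] L1_plus_Linf_measurable[OF h_X]] h_le)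
       (use c in simp)
  with h_le average_minus_average_of_average[OF T f_X m] show ?thesis
  proof eventually_elim
    case (elim x)
    show ?case
    proof
      fix N
      have "\<bar>h x - (T ^^ N) h x\<bar> \<le> 2 * real m * c"
        using elim(1) elim(3)[rule_format, of N] by linarith
      then show "\<bar>ergodic_average T N f x - ergodic_average T N (ergodic_average T m f) x\<bar>
           \<le> 2 * real m * c / real N"
        using elim(2) by (simp add: h_def[symmetric] divide_right_mono)
    qed
  qed
qed

text \<open>Let \<open>u\<^sub>i = A\<^sub>i f\<close>. For a fixed number \<open>n\<close> of steps, \<open>A\<^sub>n u\<^sub>i - u\<^sub>i\<close> is uniformly small for
  large \<open>i\<close>, and \<open>A\<^sub>n (u\<^sub>m - u\<^sub>i)\<close> is small for all \<open>n\<close> simultaneously, off a small set, by the mean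
  ergodic theorem and the maximal inequality. Hence \<open>A\<^sub>n u\<^sub>m\<close> stays near \<open>u\<^sub>m\<close>, first for
  finitely many \<open>n\<close> and then, by continuity of the measure, for all \<open>n\<close>; and \<open>A\<^sub>n f\<close> is asymptotic
  to \<open>A\<^sub>n u\<^sub>m\<close>. The late average \<open>u\<^sub>m\<close> plays the part of the invariant limit function.\<close>

lemma nearly_convergent_L1_bounded:
  assumes M: "sigma_finite_measure M" and T: "dunford_schwartz M T"
    and f: "f \<in> L1 M" and c: "0 \<le> c" "AE x in M. \<bar>f x\<bar> \<le> c"
  shows "nearly_convergent M T f"
  unfolding nearly_convergent_def
proof (intro allI impI)
  fix e d :: real assume e: "0 < e" and d: "0 < d"
  \<comment> \<open>\<open>A\<^sub>n f\<close> will end up within \<open>6 l\<close> of \<open>u\<^sub>m\<close>, so that two averages differ by at most \<open>12 l\<close>.\<close>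
  define l where "l = e / 12"
  have l: "0 < l" using e by (simp add: l_def)
  have f_X: "f \<in> L1_plus_Linf M" and f_meas: "f \<in> borel_measurable M"
    using f by (auto intro: L1_subset simp: L1_iff)
  have f2: "f \<in> L2 M" by (rule L1_bounded_in_L2[OF f c(2)])
  let ?A = "ergodic_average T"
  note avg = ds_ergodic_average[OF T]
  obtain m where m: "0 < m" and Cauchy: "\<And>i j. m \<le> i \<Longrightarrow> m \<le> j \<Longrightarrow>
      (\<integral>x. (?A i f x - ?A j f x)\<^sup>2 \<partial>M) \<le> 4 * l\<^sup>2 * d"
    using L2_averages_Cauchy[OF M T f2, of "4 * l\<^sup>2 * d"] l d by auto
  define u where "u i = ?A i f" for i
  have u_X: "u i \<in> L1_plus_Linf M" for i
    unfolding u_def by (rule ds_L1_plus_Linf[OF avg f_X])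
  have u2: "u i \<in> L2 M" for i
    unfolding u_def by (rule ds_L2(1)[OF M avg f2])
  have [measurable]: "u i \<in> borel_measurable M" "?A n (u i) \<in> borel_measurable M" for i n
    using L1_plus_Linf_measurable[OF u_X] L1_plus_Linf_measurable[OF ds_L1_plus_Linf[OF avg u_X]] .

  \<comment> \<open>\<open>A\<^sub>n u\<^sub>m\<close>, \<open>A\<^sub>n u\<^sub>i\<close>, \<open>u\<^sub>i\<close>, \<open>u\<^sub>m\<close> are consecutively within \<open>2 l\<close>, \<open>l\<close>, \<open>2 l\<close>, whence the bound \<open>5 l\<close>.\<close>
  define D where "D N = {x \<in> space M. \<exists>n\<le>N. 5 * l < \<bar>?A n (u m) x - u m x\<bar> \<and> 0 < n}" for N
  have D_sets [measurable]: "D N \<in> sets M" for N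
    unfolding D_def by measurable
  have D_le: "emeasure M (D N) \<le> ennreal d" for N
  proof -
    obtain i0 :: nat where i0: "2 * real N * c / l < real i0"
      using reals_Archimedean2 by blast
    define i where "i = max m i0"
    have i: "m \<le> i" "0 < i" "2 * real N * c / real i \<le> l"
    proof -
      show i_pos: "m \<le> i" "0 < i" using m by (auto simp: i_def)
      have "2 * real N * c / l \<le> real i" using i0 by (simp add: i_def)
      then show "2 * real N * c / real i \<le> l"
        using i_pos l by (simp add: field_simps)
    qed
    have diff2: "(\<lambda>x. u m x - u i x) \<in> L2 M"
      by (rule L2_diff[OF u2 u2])
    obtain B where B: "B \<in> sets M"
      "ennreal (4 * l\<^sup>2) * emeasure M B \<le> (\<integral>\<^sup>+x. ennreal ((u m x - u i x)\<^sup>2) \<partial>M)"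
      and B_max: "AE x in M. x \<notin> B \<longrightarrow> (\<forall>n. \<bar>?A n (\<lambda>x. u m x - u i x) x\<bar> \<le> 2 * l)"
      by (rule maximal_inequality_L2[OF T L2_subset[OF diff2] l]) (use diff2 in \<open>simp_all add: L2_iff\<close>)
    have B_le: "emeasure M B \<le> ennreal d"
    proof -
      note B(2)
      also have "(\<integral>\<^sup>+x. ennreal ((u m x - u i x)\<^sup>2) \<partial>M) = ennreal (\<integral>x. (u m x - u i x)\<^sup>2 \<partial>M)"
        by (rule nn_integral_square[OF diff2])
      also have "\<dots> \<le> ennreal (4 * l\<^sup>2 * d)"
        unfolding u_def by (intro ennreal_leI Cauchy i) simp
      finally have "ennreal (4 * l\<^sup>2) * emeasure M B \<le> ennreal (4 * l\<^sup>2) * ennreal d"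
        by (simp add: ennreal_mult')
      then show ?thesis
        using l by (subst (asm) ennreal_mult_le_mult_iff) auto
    qed
    have "AE x in M. \<forall>n. ?A n (\<lambda>y. u m y - u i y) x = ?A n (u m) x - ?A n (u i) x"
      unfolding AE_all_countable by (intro allI ds_diff[OF avg u_X u_X])
    moreover have "AE x in M. \<forall>n. ?A n (u i) x = ?A i (?A n f) x"
      unfolding AE_all_countable u_def by (intro allI averages_commute[OF T f_X])
    moreover have "AE x in M. \<forall>n. 0 < n \<longrightarrow> (\<forall>j. \<bar>?A j f x - ?A j (?A n f) x\<bar> \<le> 2 * real n * c / real j)"
      unfolding AE_all_countable
      by (intro allI AE_impI) (rule bounded_averages_almost_fixed[OF T f_meas c])
    ultimately have "AE x in M. x \<in> D N \<longrightarrow> x \<in> B"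
      using B_max
    proof eventually_elim
      case (elim x)
      show ?case
      proof (rule impI, rule ccontr)
        assume "x \<in> D N" and x: "x \<notin> B"
        then obtain n where n: "n \<le> N" "0 < n" "5 * l < \<bar>?A n (u m) x - u m x\<bar>"
          by (auto simp: D_def)
        have dist: "\<bar>?A k (u m) x - ?A k (u i) x\<bar> \<le> 2 * l" for k
          using elim(1,4) x by simp
        have one: "?A 1 g x = g x" for g
          by (simp add: ergodic_average_def)
        have "\<bar>?A i f x - ?A i (?A n f) x\<bar> \<le> 2 * real n * c / real i"
          using elim(3) n(2) by blast
        then have "\<bar>u i x - ?A n (u i) x\<bar> \<le> 2 * real n * c / real i"
          using elim(2) by (simp add: u_def)
        also have "\<dots> \<le> 2 * real N * c / real i"
          using n c by (intro divide_right_mono mult_right_mono) auto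
        also have "\<dots> \<le> l" by (rule i)
        finally have "\<bar>u i x - ?A n (u i) x\<bar> \<le> l" .
        with dist[of n] dist[of 1] n(3) show False
          unfolding one by linarith
      qed
    qed
    then have "emeasure M (D N) \<le> emeasure M B"
      by (rule emeasure_mono_AE) fact
    with B_le show ?thesis by (rule order_trans[rotated])
  qed
  define E where "E = (\<Union>N. D N)"
  have "incseq D"
    by (rule incseq_SucI) (auto simp: D_def intro: le_SucI)
  then have "emeasure M E = (SUP N. emeasure M (D N))"
    unfolding E_def by (intro SUP_emeasure_incseq[symmetric]) auto
  then have E_le: "emeasure M E \<le> ennreal d"
    by (simp add: SUP_le_iff D_le)
  have "AE x in M. x \<notin> E \<longrightarrow>
      (\<exists>K. \<forall>m\<ge>K. \<forall>n\<ge>K. \<bar>?A m f x - ?A n f x\<bar> \<le> e)"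
    using bounded_averages_almost_fixed[OF T f_meas c m] AE_space
  proof eventually_elim
    case (elim x)
    show ?case
    proof
      assume x: "x \<notin> E"
      have near: "\<bar>?A n (u m) x - u m x\<bar> \<le> 5 * l" if "0 < n" for n
        using x elim(2) that by (force simp: E_def D_def not_less)
      obtain K0 :: nat where K0: "2 * real m * c / l < real K0"
        using reals_Archimedean2 by blast
      have close: "\<bar>?A n f x - u m x\<bar> \<le> 6 * l" if n: "Suc K0 \<le> n" for n
      proof -
        have "2 * real m * c / l \<le> real n" using K0 n by simp
        then have "2 * real m * c / real n \<le> l"
          using l n by (simp add: field_simps)
        then have "\<bar>?A n f x - ?A n (u m) x\<bar> \<le> l"
          using elim(1)[rule_format, of n] by (simp add: u_def)
        with near[of n] n show ?thesis by linarith
      qed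
      have "\<bar>?A i f x - ?A j f x\<bar> \<le> e" if "Suc K0 \<le> i" "Suc K0 \<le> j" for i j
        using close[OF that(1)] close[OF that(2)] unfolding l_def by linarith
      then show "\<exists>K. \<forall>m\<ge>K. \<forall>n\<ge>K. \<bar>?A m f x - ?A n f x\<bar> \<le> e"
        by blast
    qed
  qed
  moreover have "E \<in> sets M" unfolding E_def by auto
  ultimately show "\<exists>B\<in>sets M. emeasure M B \<le> ennreal d \<and>
        (AE x in M. x \<notin> B \<longrightarrow>
           (\<exists>K. \<forall>m\<ge>K. \<forall>n\<ge>K. \<bar>ergodic_average T m f x - ergodic_average T n f x\<bar> \<le> e))"
    using E_le by blast
qed

lemma excess_tendsto_0:
  assumes "f \<in> L1 M"
  shows "(\<lambda>i. \<integral>\<^sup>+x. ennreal (\<bar>f x\<bar> - real i) \<partial>M) \<longlonglongrightarrow> 0"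
proof -
  have [measurable]: "f \<in> borel_measurable M" and fin: "(\<integral>\<^sup>+x. ennreal \<bar>f x\<bar> \<partial>M) < \<infinity>"
    using assms by (auto simp: L1_iff)
  have "(\<lambda>i. \<integral>\<^sup>+x. ennreal (\<bar>f x\<bar> - real i) \<partial>M) \<longlonglongrightarrow> (\<integral>\<^sup>+x. 0 \<partial>M)"
  proof (rule nn_integral_dominated_convergence[where w = "\<lambda>x. ennreal \<bar>f x\<bar>"])
    show "AE x in M. (\<lambda>i. ennreal (\<bar>f x\<bar> - real i)) \<longlonglongrightarrow> 0"
    proof (rule AE_I2)
      fix x
      obtain k :: nat where k: "\<bar>f x\<bar> < real k"
        using reals_Archimedean2 by blast
      have "\<forall>\<^sub>F i in sequentially. ennreal (\<bar>f x\<bar> - real i) = 0"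
        using eventually_ge_at_top[of k] by eventually_elim (use k in \<open>simp add: ennreal_neg\<close>)
      then show "(\<lambda>i. ennreal (\<bar>f x\<bar> - real i)) \<longlonglongrightarrow> 0"
        by (rule tendsto_eventually)
    qed
    show "AE x in M. ennreal (\<bar>f x\<bar> - real i) \<le> ennreal \<bar>f x\<bar>" for i
      by (auto intro!: AE_I2 ennreal_leI)
  qed (use fin in auto)
  then show ?thesis by simp
qed

lemma nearly_convergent_L1:
  assumes M: "sigma_finite_measure M" and T: "dunford_schwartz M T" and f: "f \<in> L1 M"
  shows "nearly_convergent M T f"
proof (rule nearly_convergent_approx)
  fix e d :: real assume e: "0 < e" and d: "0 < d"
  have [measurable]: "f \<in> borel_measurable M" and fin: "(\<integral>\<^sup>+x. ennreal \<bar>f x\<bar> \<partial>M) < \<infinity>"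
    using f by (auto simp: L1_iff)
  have "\<forall>\<^sub>F i in sequentially. (\<integral>\<^sup>+x. ennreal (\<bar>f x\<bar> - real i) \<partial>M) < ennreal (e * d)"
    using excess_tendsto_0[OF f] by (rule order_tendstoD) (use e d in simp)
  then obtain i :: nat where i: "(\<integral>\<^sup>+x. ennreal (\<bar>f x\<bar> - real i) \<partial>M) < ennreal (e * d)"
    by (auto simp: eventually_sequentially)
  let ?g = "\<lambda>x. clip (real i) (f x)" and ?r = "\<lambda>x. f x - clip (real i) (f x)"
  have r_int: "(\<integral>\<^sup>+x. ennreal \<bar>?r x\<bar> \<partial>M) = (\<integral>\<^sup>+x. ennreal (\<bar>f x\<bar> - real i) \<partial>M)"
    by (simp add: ennreal_abs_diff_clip)
  have r: "?r \<in> L1 M"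
    using less_trans[OF i] by (simp add: L1_iff r_int)
  have g: "?g \<in> L1 M"
  proof -
    have "(\<integral>\<^sup>+x. ennreal \<bar>?g x\<bar> \<partial>M) \<le> (\<integral>\<^sup>+x. ennreal \<bar>f x\<bar> \<partial>M)"
      by (intro nn_integral_mono ennreal_leI abs_clip_le_abs) simp
    then show ?thesis using fin by (simp add: L1_iff)
  qed
  have "nearly_convergent M T ?g"
    by (rule nearly_convergent_L1_bounded[OF M T g, of "real i"]) (auto simp: abs_clip_le)
  moreover obtain B where B: "B \<in> sets M" "ennreal e * emeasure M B \<le> (\<integral>\<^sup>+x. ennreal \<bar>?r x\<bar> \<partial>M)"
    "AE x in M. x \<notin> B \<longrightarrow> (\<forall>n. \<bar>ergodic_average T n ?r x\<bar> \<le> e)"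
    using maximal_inequality[OF T r e] .
  moreover have "emeasure M B \<le> ennreal d"
  proof -
    have "ennreal e * emeasure M B \<le> ennreal e * ennreal d"
      using B(2) i e by (simp add: r_int ennreal_mult')
    then show ?thesis
      using e by (subst (asm) ennreal_mult_le_mult_iff) auto
  qed
  moreover have "AE x in M. x \<notin> B \<longrightarrow> (\<forall>n. \<bar>ergodic_average T n f x - ergodic_average T n ?g x\<bar> \<le> e)"
  proof -
    have "AE x in M. \<forall>n. ergodic_average T n ?r x = ergodic_average T n f x - ergodic_average T n ?g x"
      unfolding AE_all_countable
      by (intro allI ds_diff[OF ds_ergodic_average[OF T]] L1_subset f g)
    with B(3) show ?thesis by eventually_elim simp
  qed
  ultimately show "\<exists>g. nearly_convergent M T g \<and>
      (\<exists>B\<in>sets M. emeasure M B \<le> ennreal d \<and>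
        (AE x in M. x \<notin> B \<longrightarrow> (\<forall>n. \<bar>ergodic_average T n f x - ergodic_average T n g x\<bar> \<le> e)))"
    by blast
qed

lemma AE_convergent_averages:
  assumes M: "sigma_finite_measure M" and T: "dunford_schwartz M T" and f: "f \<in> borel_measurable M"
    and fin: "\<And>c. 0 < c \<Longrightarrow> (\<integral>\<^sup>+x. ennreal (\<bar>f x\<bar> - c) \<partial>M) < \<infinity>"
  shows "AE x in M. convergent (\<lambda>n. ergodic_average T n f x)"
proof (rule nearly_convergent_AE_convergent, rule nearly_convergent_approx)
  fix e d :: real assume e: "0 < e" and "0 < d"
  have e0: "0 \<le> e" using e by simp
  note [measurable] = f
  let ?b = "\<lambda>x. clip e (f x)" and ?r = "\<lambda>x. f x - clip e (f x)"
  have r: "?r \<in> L1 M"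
    using fin[OF e] by (simp add: L1_iff ennreal_abs_diff_clip[OF e0])
  have b: "?b \<in> L1_plus_Linf M"
    by (rule bounded_in_L1_plus_Linf[where c = e]) (auto simp: abs_clip_le[OF e0])
  have "AE x in M. \<forall>n. ergodic_average T n (\<lambda>y. ?b y + ?r y) x
      = ergodic_average T n ?b x + ergodic_average T n ?r x"
    unfolding AE_all_countable
    by (intro allI ds_add[OF ds_ergodic_average[OF T]] b L1_subset[OF r])
  moreover have "AE x in M. \<forall>n. \<bar>ergodic_average T n ?b x\<bar> \<le> e"
    unfolding AE_all_countable
    by (intro allI ds_AE_bounded[OF ds_ergodic_average[OF T]]) (auto simp: abs_clip_le[OF e0] e0)
  ultimately have "AE x in M. x \<notin> {} \<longrightarrow>
      (\<forall>n. \<bar>ergodic_average T n f x - ergodic_average T n ?r x\<bar> \<le> e)"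
    by eventually_elim simp
  then show "\<exists>g. nearly_convergent M T g \<and>
      (\<exists>B\<in>sets M. emeasure M B \<le> ennreal d \<and>
        (AE x in M. x \<notin> B \<longrightarrow> (\<forall>n. \<bar>ergodic_average T n f x - ergodic_average T n g x\<bar> \<le> e)))"
    using nearly_convergent_L1[OF M T r]
    by (intro exI[of _ ?r] conjI bexI[of _ "{}"]) auto
qed

section \<open>Rearrangements and submajorization\<close>

lemma nn_integral_excess_layers:
  assumes M: "sigma_finite_measure M" and f [measurable]: "f \<in> borel_measurable M"
  shows "(\<integral>\<^sup>+x. ennreal (\<bar>f x\<bar> - c) \<partial>M)
       = (\<integral>\<^sup>+l. emeasure M {x \<in> space M. l < \<bar>f x\<bar>} * indicator {c<..} l \<partial>lborel)"
proof -
  interpret sigma_finite_measure M by fact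
  interpret P: pair_sigma_finite M lborel ..
  have layer: "ennreal (a - c) = (\<integral>\<^sup>+l. (if c < l \<and> l < a then 1 else 0) \<partial>lborel)" for a
  proof -
    have "(\<integral>\<^sup>+l. (if c < l \<and> l < a then 1 else 0) \<partial>lborel) = (\<integral>\<^sup>+l. indicator {c<..<a} l \<partial>lborel)"
      by (intro nn_integral_cong) (simp add: indicator_def)
    also have "\<dots> = ennreal (a - c)"
      by (cases "c \<le> a") (simp_all add: ennreal_neg)
    finally show ?thesis by simp
  qed
  have "(\<integral>\<^sup>+x. ennreal (\<bar>f x\<bar> - c) \<partial>M)
      = (\<integral>\<^sup>+x. (\<integral>\<^sup>+l. (if c < l \<and> l < \<bar>f x\<bar> then 1 else 0) \<partial>lborel) \<partial>M)"
    by (simp add: layer)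
  also have "\<dots> = (\<integral>\<^sup>+l. (\<integral>\<^sup>+x. (if c < l \<and> l < \<bar>f x\<bar> then 1 else 0) \<partial>M) \<partial>lborel)"
    by (rule P.Fubini'[symmetric]) measurable
  also have "\<dots> = (\<integral>\<^sup>+l. emeasure M {x \<in> space M. l < \<bar>f x\<bar>} * indicator {c<..} l \<partial>lborel)"
  proof (rule nn_integral_cong)
    fix l
    have "(\<integral>\<^sup>+x. (if c < l \<and> l < \<bar>f x\<bar> then 1 else 0) \<partial>M)
        = (\<integral>\<^sup>+x. indicator {c<..} l * indicator {x \<in> space M. l < \<bar>f x\<bar>} x \<partial>M)"
      by (intro nn_integral_cong) (simp add: indicator_def)
    then show "(\<integral>\<^sup>+x. (if c < l \<and> l < \<bar>f x\<bar> then 1 else 0) \<partial>M)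
        = emeasure M {x \<in> space M. l < \<bar>f x\<bar>} * indicator {c<..} l"
      by (simp add: nn_integral_cmult_indicator mult.commute)
  qed
  finally show ?thesis .
qed

lemma distribution_finite:
  assumes f: "f \<in> L1_plus_Linf M" and t: "0 < t"
  obtains l where "0 < l" "emeasure M {x \<in> space M. l < \<bar>f x\<bar>} \<le> ennreal t"
proof -
  obtain c where [measurable]: "f \<in> borel_measurable M"
    and c: "0 \<le> c" "(\<integral>\<^sup>+x. ennreal (\<bar>f x\<bar> - c) \<partial>M) < \<infinity>"
    using f by (auto simp: L1_plus_Linf_iff)
  then obtain K where K: "0 \<le> K" "(\<integral>\<^sup>+x. ennreal (\<bar>f x\<bar> - c) \<partial>M) = ennreal K"
    by (cases "\<integral>\<^sup>+x. ennreal (\<bar>f x\<bar> - c) \<partial>M") auto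
  \<comment> \<open>Chebyshev above the height \<open>c\<close>: there \<open>\<bar>f\<bar> > c + b\<close> on a set of measure at most \<open>K / b\<close>.\<close>
  define b where "b = (K + 1) / t"
  have b: "0 < b" using K t by (simp add: b_def)
  let ?S = "{x \<in> space M. c + b < \<bar>f x\<bar>}"
  have "ennreal b * emeasure M ?S = (\<integral>\<^sup>+x. ennreal b * indicator ?S x \<partial>M)"
    by (simp add: nn_integral_cmult_indicator)
  also have "\<dots> \<le> (\<integral>\<^sup>+x. ennreal (\<bar>f x\<bar> - c) \<partial>M)"
    by (intro nn_integral_mono) (auto simp: indicator_def intro!: ennreal_leI)
  also have "\<dots> \<le> ennreal (b * t)"
    unfolding K using K t by (intro ennreal_leI) (simp add: b_def)
  also have "\<dots> = ennreal b * ennreal t"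
    using b by (simp add: ennreal_mult')
  finally have "emeasure M ?S \<le> ennreal t"
    using b by (subst (asm) ennreal_mult_le_mult_iff) auto
  then show thesis
    using b c(1) by (intro that[of "c + b"]) auto
qed

text \<open>The distribution function is continuous from the right, so that it and the rearrangement are
  inverse to each other in the sense of a Galois connection.\<close>

lemma less_rearrangement_iff:
  assumes f: "f \<in> L1_plus_Linf M" and t: "0 < t" and l: "0 \<le> l"
  shows "l < rearrangement M f t \<longleftrightarrow> ennreal t < emeasure M {x \<in> space M. l < \<bar>f x\<bar>}"
proof -
  have [measurable]: "f \<in> borel_measurable M"
    using f by (rule L1_plus_Linf_measurable)
  define D where "D k = emeasure M {x \<in> space M. k < \<bar>f x\<bar>}" for k
  define S where "S = {k. k > 0 \<and> D k \<le> ennreal t}"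
  have rearr: "rearrangement M f t = Inf S"
    by (simp add: rearrangement_def S_def D_def)
  have bdd: "bdd_below S"
    by (rule bdd_belowI[of _ 0]) (simp add: S_def)
  have D_mono: "D k \<le> D k'" if "k' \<le> k" for k k'
    unfolding D_def using that by (intro emeasure_mono) auto
  have ne: "S \<noteq> {}"
    using distribution_finite[OF f t] by (auto simp: S_def D_def)
  show ?thesis
  proof
    assume less: "l < rearrangement M f t"
    show "ennreal t < emeasure M {x \<in> space M. l < \<bar>f x\<bar>}"
    proof (rule ccontr)
      assume "\<not> ?thesis"
      then have D_l: "D l \<le> ennreal t" by (simp add: D_def not_less)
      have "Inf S \<le> l"
      proof (rule field_le_epsilon)
        fix e :: real assume "0 < e"
        then have "l + e \<in> S"
          using l order_trans[OF D_mono D_l, of "l + e"] by (simp add: S_def)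
        then show "Inf S \<le> l + e" by (rule cInf_lower[OF _ bdd])
      qed
      with less show False by (simp add: rearr)
    qed
  next
    assume less: "ennreal t < emeasure M {x \<in> space M. l < \<bar>f x\<bar>}"
    define U where "U n = {x \<in> space M. l + 1 / real (Suc n) < \<bar>f x\<bar>}" for n
    have "incseq U"
    proof (rule incseq_SucI)
      fix n
      have "1 / real (Suc (Suc n)) \<le> 1 / real (Suc n)"
        by (intro divide_left_mono) auto
      then show "U n \<subseteq> U (Suc n)"
        unfolding U_def by (auto intro: le_less_trans[rotated])
    qed
    have "(\<Union>n. U n) = {x \<in> space M. l < \<bar>f x\<bar>}"
    proof safe
      fix x assume "x \<in> space M" "l < \<bar>f x\<bar>"
      then obtain n where "1 / real (Suc n) < \<bar>f x\<bar> - l"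
        using reals_Archimedean[of "\<bar>f x\<bar> - l"] by (auto simp: inverse_eq_divide)
      then show "x \<in> (\<Union>n. U n)"
        using \<open>x \<in> space M\<close> by (auto simp: U_def intro!: exI[of _ n])
    next
      fix x n assume x: "x \<in> U n"
      then show "x \<in> space M" by (simp add: U_def)
      have "0 \<le> 1 / real (Suc n)" by simp
      then show "l < \<bar>f x\<bar>"
        using x unfolding U_def mem_Collect_eq by linarith
    qed
    moreover have "emeasure M (\<Union>n. U n) = (SUP n. emeasure M (U n))"
      by (rule SUP_emeasure_incseq[symmetric, OF _ \<open>incseq U\<close>]) (auto simp: U_def)
    ultimately obtain n where n: "ennreal t < D (l + 1 / real (Suc n))"
      using less by (auto simp: less_SUP_iff D_def U_def)
    have "l + 1 / real (Suc n) \<le> Inf S"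
    proof (rule cInf_greatest[OF ne])
      fix k assume "k \<in> S"
      then have "D k < D (l + 1 / real (Suc n))"
        using n by (auto simp: S_def)
      then show "l + 1 / real (Suc n) \<le> k"
        using D_mono[of k "l + 1 / real (Suc n)"] D_mono[of "l + 1 / real (Suc n)" k] by (meson le_cases not_less)
    qed
    moreover have "0 < 1 / real (Suc n)" by simp
    ultimately show "l < rearrangement M f t"
      unfolding rearr by linarith
  qed
qed

lemma rearrangement_nonneg:
  assumes f: "f \<in> L1_plus_Linf M" and t: "0 < t"
  shows "0 \<le> rearrangement M f t"
  unfolding rearrangement_def
  by (rule cInf_greatest) (use distribution_finite[OF f t] in auto)

lemma rearrangement_antimono:
  assumes f: "f \<in> L1_plus_Linf M" and s: "0 < s" and le: "s \<le> t"
  shows "rearrangement M f t \<le> rearrangement M f s"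
proof (rule ccontr)
  assume "\<not> ?thesis"
  then have less: "rearrangement M f s < rearrangement M f t" by simp
  have t: "0 < t" using s le by simp
  note nonneg = rearrangement_nonneg[OF f s]
  have "ennreal s \<le> ennreal t" using le by (rule ennreal_leI)
  also have "\<dots> < emeasure M {x \<in> space M. rearrangement M f s < \<bar>f x\<bar>}"
    using less by (simp add: less_rearrangement_iff[OF f t nonneg])
  finally show False
    using less_rearrangement_iff[OF f s nonneg] by simp
qed

lemma emeasure_lborel_initial: "emeasure lborel {t. 0 < t \<and> ennreal t < D} = D"
proof (cases D)
  case (real r)
  then have "{t. 0 < t \<and> ennreal t < D} = {0<..<r}"
    by (auto simp: ennreal_less_iff)
  then show ?thesis using real by simp
next
  case top
  have "ennreal (real n) \<le> emeasure lborel {t::real. 0 < t}" for n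
  proof -
    have "ennreal (real n) = emeasure lborel {0<..<real n}" by simp
    also have "\<dots> \<le> emeasure lborel {t::real. 0 < t}"
      by (intro emeasure_mono) auto
    finally show ?thesis .
  qed
  then have "emeasure lborel {t::real. 0 < t} = top"
    by (metis ennreal_of_nat_eq_real_of_nat ennreal_Ex_less_of_nat less_top not_less)
  then show ?thesis using top by simp
qed

lemma rearrangement_superlevel:
  assumes f: "f \<in> L1_plus_Linf M" and l: "0 \<le> l"
  shows "{t. l < rearrangement M f t * indicator {0<..} t}
       = {t. 0 < t \<and> ennreal t < emeasure M {x \<in> space M. l < \<bar>f x\<bar>}}"
  using l less_rearrangement_iff[OF f _ l] by (auto simp: indicator_def split: if_splits)

lemma rearrangement_measurable:
  assumes f: "f \<in> L1_plus_Linf M"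
  shows "(\<lambda>t. rearrangement M f t * indicator {0<..} t) \<in> borel_measurable borel"
  unfolding borel_measurable_iff_greater
proof
  fix l :: real
  show "{t \<in> space borel. l < rearrangement M f t * indicator {0<..} t} \<in> sets borel"
  proof (cases "0 \<le> l")
    case True
    have "{t. 0 < t \<and> ennreal t < emeasure M {x \<in> space M. l < \<bar>f x\<bar>}} \<in> sets borel"
      by measurable
    then show ?thesis
      using rearrangement_superlevel[OF f True] by simp
  next
    case False
    then have "{t. l < rearrangement M f t * indicator {0<..} t} = UNIV"
      using rearrangement_nonneg[OF f] by (force simp: indicator_def)
    then show ?thesis by simp
  qed
qed

text \<open>The layers of the excess see only the distribution function, and a function shares it with its
  rearrangement.\<close>

lemma rearrangement_excess:
  assumes M: "sigma_finite_measure M" and f: "f \<in> L1_plus_Linf M" and c: "0 \<le> c"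
  shows "(\<integral>\<^sup>+t. ennreal (rearrangement M f t * indicator {0<..} t - c) \<partial>lborel)
       = (\<integral>\<^sup>+x. ennreal (\<bar>f x\<bar> - c) \<partial>M)"
proof -
  let ?r = "\<lambda>t. rearrangement M f t * indicator {0<..} t"
  have [measurable]: "?r \<in> borel_measurable lborel"
    using rearrangement_measurable[OF f] by simp
  have abs_r: "\<bar>?r t\<bar> = ?r t" for t
    using rearrangement_nonneg[OF f, of t] by (auto simp: indicator_def)
  have "(\<integral>\<^sup>+t. ennreal (\<bar>?r t\<bar> - c) \<partial>lborel)
      = (\<integral>\<^sup>+l. emeasure lborel {t \<in> space lborel. l < \<bar>?r t\<bar>} * indicator {c<..} l \<partial>lborel)"
    by (rule nn_integral_excess_layers) (simp_all add: lborel.sigma_finite_measure_axioms)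
  also have "\<dots> = (\<integral>\<^sup>+l. emeasure M {x \<in> space M. l < \<bar>f x\<bar>} * indicator {c<..} l \<partial>lborel)"
  proof (rule nn_integral_cong)
    fix l
    show "emeasure lborel {t \<in> space lborel. l < \<bar>?r t\<bar>} * indicator {c<..} l
        = emeasure M {x \<in> space M. l < \<bar>f x\<bar>} * indicator {c<..} l"
    proof (cases "c < l")
      case True
      then have "{t. l < ?r t} = {t. 0 < t \<and> ennreal t < emeasure M {x \<in> space M. l < \<bar>f x\<bar>}}"
        using c by (intro rearrangement_superlevel[OF f]) simp
      then show ?thesis
        by (simp add: abs_r emeasure_lborel_initial)
    qed simp
  qed
  also have "\<dots> = (\<integral>\<^sup>+x. ennreal (\<bar>f x\<bar> - c) \<partial>M)"
    by (rule nn_integral_excess_layers[symmetric, OF M L1_plus_Linf_measurable[OF f]])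
  finally show ?thesis by (simp add: abs_r)
qed

text \<open>The Hardy-Littlewood-Polya characterization: \<open>\<integral>\<^sub>0\<^sup>s \<mu>\<^sub>t(g) dt\<close> is the minimum over \<open>c\<close> of
  \<open>s c + \<integral> (\<bar>g\<bar> - c)\<^sup>+\<close>, attained at \<open>c = \<mu>\<^sub>s(g)\<close>. Heights slightly above
  \<open>\<mu>\<^sub>s(f)\<close> serve here, since they are positive.\<close>

lemma submajorized_if_excess_le:
  assumes M: "sigma_finite_measure M" and f: "f \<in> L1_plus_Linf M" and g: "g \<in> L1_plus_Linf M"
    and le: "\<And>c. 0 < c \<Longrightarrow> (\<integral>\<^sup>+x. ennreal (\<bar>g x\<bar> - c) \<partial>M) \<le> (\<integral>\<^sup>+x. ennreal (\<bar>f x\<bar> - c) \<partial>M)"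
  shows "submajorized M g f"
  unfolding submajorized_def
proof (intro allI impI)
  fix s :: real assume s: "0 < s"
  let ?F = "\<lambda>t. rearrangement M f t * indicator {0<..} t"
  let ?G = "\<lambda>t. rearrangement M g t * indicator {0<..} t"
  have [measurable]: "?F \<in> borel_measurable borel" "?G \<in> borel_measurable borel"
    using rearrangement_measurable[OF f] rearrangement_measurable[OF g] .
  have F_int: "(\<integral>\<^sup>+t\<in>{0<..s}. ennreal (rearrangement M f t) \<partial>lborel) = (\<integral>\<^sup>+t\<in>{0<..s}. ennreal (?F t) \<partial>lborel)"
    by (intro nn_integral_cong) (simp add: indicator_def)
  have G_int: "(\<integral>\<^sup>+t\<in>{0<..s}. ennreal (rearrangement M g t) \<partial>lborel) = (\<integral>\<^sup>+t\<in>{0<..s}. ennreal (?G t) \<partial>lborel)"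
    by (intro nn_integral_cong) (simp add: indicator_def)
  have const: "(\<integral>\<^sup>+t\<in>{0<..s}. ennreal b \<partial>lborel) = ennreal (b * s)" if "0 \<le> b" for b
    using s that by (simp add: nn_integral_cmult_indicator ennreal_mult')
  show "(\<integral>\<^sup>+t\<in>{0<..s}. ennreal (rearrangement M g t) \<partial>lborel)
      \<le> (\<integral>\<^sup>+t\<in>{0<..s}. ennreal (rearrangement M f t) \<partial>lborel)"
    unfolding F_int G_int
  proof (rule ennreal_le_epsilon)
    fix d :: real assume d: "0 < d"
    define c where "c = ?F s + d / s"
    have F_nonneg: "0 \<le> ?F t" for t
      using rearrangement_nonneg[OF f, of t] by (simp add: indicator_def)
    have c: "0 < c"
      unfolding c_def using d s F_nonneg[of s] by (simp add: add_nonneg_pos)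
    have "(\<integral>\<^sup>+t\<in>{0<..s}. ennreal (?G t) \<partial>lborel)
        \<le> (\<integral>\<^sup>+t. ennreal c * indicator {0<..s} t + ennreal (?G t - c) \<partial>lborel)"
    proof (rule nn_integral_mono)
      fix t
      have "ennreal (?G t) \<le> ennreal (c + max 0 (?G t - c))"
        by (rule ennreal_leI) simp
      also have "\<dots> = ennreal c + ennreal (?G t - c)"
        using c by (subst ennreal_plus) (auto simp: max_def ennreal_neg)
      finally show "ennreal (?G t) * indicator {0<..s} t
          \<le> ennreal c * indicator {0<..s} t + ennreal (?G t - c)"
        by (cases "t \<in> {0<..s}") simp_all
    qed
    also have "\<dots> = (\<integral>\<^sup>+t\<in>{0<..s}. ennreal c \<partial>lborel) + (\<integral>\<^sup>+t. ennreal (?G t - c) \<partial>lborel)"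
      by (rule nn_integral_add) auto
    also have "\<dots> \<le> (\<integral>\<^sup>+t\<in>{0<..s}. ennreal c \<partial>lborel) + (\<integral>\<^sup>+t. ennreal (?F t - c) \<partial>lborel)"
      using c le[of c] by (intro add_left_mono) (simp add: rearrangement_excess[OF M] f g)
    also have "\<dots> = (\<integral>\<^sup>+t. ennreal c * indicator {0<..s} t + ennreal (?F t - c) \<partial>lborel)"
      by (rule nn_integral_add[symmetric]) auto
    also have "\<dots> \<le> (\<integral>\<^sup>+t. ennreal (?F t) * indicator {0<..s} t + ennreal (d / s) * indicator {0<..s} t \<partial>lborel)"
    proof (rule nn_integral_mono)
      fix t
      show "ennreal c * indicator {0<..s} t + ennreal (?F t - c)
          \<le> ennreal (?F t) * indicator {0<..s} t + ennreal (d / s) * indicator {0<..s} t"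
      proof (cases "0 < t \<and> t \<le> s")
        case True
        then have "?F s \<le> ?F t"
          using rearrangement_antimono[OF f, of t s] by simp
        then have "c + max 0 (?F t - c) \<le> ?F t + d / s"
          using d s by (simp add: c_def max_def)
        then have "ennreal (c + max 0 (?F t - c)) \<le> ennreal (?F t + d / s)"
          by (rule ennreal_leI)
        moreover have "ennreal (c + max 0 (?F t - c)) = ennreal c + ennreal (?F t - c)"
          using c by (subst ennreal_plus) (auto simp: max_def ennreal_neg)
        moreover have "ennreal (?F t + d / s) = ennreal (?F t) + ennreal (d / s)"
          using F_nonneg d s by (subst ennreal_plus) auto
        ultimately show ?thesis using True by (simp del: indicator_simps) (simp add: indicator_def)
      next
        case False
        then have "?F t \<le> ?F s"
          using s rearrangement_antimono[OF f s, of t] F_nonneg[of s] by (cases "0 < t") auto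
        then have "?F t - c \<le> 0"
          using divide_pos_pos[OF d s] unfolding c_def by linarith
        then show ?thesis using False by (auto simp: ennreal_neg indicator_def)
      qed
    qed
    also have "\<dots> = (\<integral>\<^sup>+t\<in>{0<..s}. ennreal (?F t) \<partial>lborel) + (\<integral>\<^sup>+t\<in>{0<..s}. ennreal (d / s) \<partial>lborel)"
      by (rule nn_integral_add) auto
    also have "(\<integral>\<^sup>+t\<in>{0<..s}. ennreal (d / s) \<partial>lborel) = ennreal d"
      using d s by (subst const) auto
    finally show "(\<integral>\<^sup>+t\<in>{0<..s}. ennreal (?G t) \<partial>lborel)
        \<le> (\<integral>\<^sup>+t\<in>{0<..s}. ennreal (?F t) \<partial>lborel) + ennreal d" .
  qed
qed

lemma submajorized_if_rearrangement_le:
  "(\<And>t. 0 < t \<Longrightarrow> rearrangement M g t \<le> rearrangement M f t) \<Longrightarrow> submajorized M g f"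
  unfolding submajorized_def
  by (intro allI impI nn_integral_mono) (auto simp: indicator_def intro!: ennreal_leI)

lemma rearrangement_le_bound:
  assumes f: "f \<in> borel_measurable M" and c: "0 \<le> c" "AE x in M. \<bar>f x\<bar> \<le> c" and t: "0 < t"
  shows "rearrangement M f t \<le> c"
proof -
  note f_X = bounded_in_L1_plus_Linf[OF f c(2)]
  note [measurable] = f
  have "emeasure M {x \<in> space M. c < \<bar>f x\<bar>} = 0"
    using c(2) by (subst (asm) AE_iff_measurable[OF _ refl]) (auto simp: not_le)
  then have "\<not> c < rearrangement M f t"
    by (simp add: less_rearrangement_iff[OF f_X t c(1)])
  then show ?thesis by simp
qed

section \<open>Vanishing rearrangement\<close>

lemma R_space_excess_finite:
  assumes f: "f \<in> R_space M" and c: "0 < c"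
  shows "(\<integral>\<^sup>+x. ennreal (\<bar>f x\<bar> - c) \<partial>M) < \<infinity>"
proof -
  have f_X: "f \<in> L1_plus_Linf M" and lim: "(rearrangement M f \<longlongrightarrow> 0) at_top"
    using f by (auto simp: R_space_def)
  obtain b where [measurable]: "f \<in> borel_measurable M"
    and b: "0 \<le> b" "(\<integral>\<^sup>+x. ennreal (\<bar>f x\<bar> - b) \<partial>M) < \<infinity>"
    using f_X by (auto simp: L1_plus_Linf_iff)
  have "\<forall>\<^sub>F t in at_top. rearrangement M f t < c \<and> 0 < t"
    using order_tendstoD(2)[OF lim c] eventually_gt_at_top[of 0] by eventually_elim simp
  then obtain t where t: "rearrangement M f t < c" "0 < t"
    by (auto simp: eventually_at_top_linorder)
  let ?S = "{x \<in> space M. c < \<bar>f x\<bar>}"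
  have "emeasure M ?S \<le> ennreal t"
    using t c less_rearrangement_iff[OF f_X t(2), of c] by (simp add: not_less[symmetric])
  then have S: "emeasure M ?S < \<infinity>"
    by (rule le_less_trans) simp
  have "(\<integral>\<^sup>+x. ennreal (\<bar>f x\<bar> - c) \<partial>M) \<le> (\<integral>\<^sup>+x. ennreal (\<bar>f x\<bar> - b) + ennreal b * indicator ?S x \<partial>M)"
  proof (rule nn_integral_mono)
    fix x assume x: "x \<in> space M"
    show "ennreal (\<bar>f x\<bar> - c) \<le> ennreal (\<bar>f x\<bar> - b) + ennreal b * indicator ?S x"
    proof (cases "c < \<bar>f x\<bar>")
      case True
      have "ennreal (\<bar>f x\<bar> - c) \<le> ennreal (max 0 (\<bar>f x\<bar> - b) + b)"
        using c by (intro ennreal_leI) auto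
      also have "\<dots> = ennreal (\<bar>f x\<bar> - b) + ennreal b"
        using b by (subst ennreal_plus) (auto simp: max_def ennreal_neg)
      finally show ?thesis using True x by simp
    qed (simp add: ennreal_neg)
  qed
  also have "\<dots> = (\<integral>\<^sup>+x. ennreal (\<bar>f x\<bar> - b) \<partial>M) + ennreal b * emeasure M ?S"
    by (subst nn_integral_add) (auto simp: nn_integral_cmult_indicator)
  also have "\<dots> < \<infinity>"
    using b S by (simp add: ennreal_mult_less_top)
  finally show ?thesis .
qed

text \<open>The limit \<open>fhat\<close> has no more mass above any height than \<open>f\<close>, by Fatou's lemma, because the
  averages do not; hence it is submajorized by \<open>f\<close>, and full symmetry puts it into the
  space.\<close>

lemma individual_ergodic_property_if_R_space:
  assumes M: "sigma_finite_measure M" and sub: "E \<subseteq> R_space M"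
    and symm: "\<And>f g. f \<in> E \<Longrightarrow> g \<in> L1_plus_Linf M \<Longrightarrow> submajorized M g f \<Longrightarrow> g \<in> E"
  shows "individual_ergodic_property M E"
  unfolding individual_ergodic_property_def
proof (intro ballI allI impI)
  fix f T assume f: "f \<in> E" and T: "dunford_schwartz M T"
  let ?A = "\<lambda>n. ergodic_average T n f"
  have fR: "f \<in> R_space M" using f sub by blast
  then have f_X: "f \<in> L1_plus_Linf M" by (simp add: R_space_def)
  have [measurable]: "?A n \<in> borel_measurable M" for n
    by (rule ds_measurable[OF ds_ergodic_average[OF T] f_X])
  define fhat where "fhat x = lim (\<lambda>n. ?A n x)" for x
  have [measurable]: "fhat \<in> borel_measurable M"
    unfolding fhat_def[abs_def] by (rule borel_measurable_lim_metric) measurable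
  have conv: "AE x in M. (\<lambda>n. ?A n x) \<longlonglongrightarrow> fhat x"
    using AE_convergent_averages[OF M T L1_plus_Linf_measurable[OF f_X] R_space_excess_finite[OF fR]]
    by (simp add: fhat_def convergent_LIMSEQ_iff)
  have excess: "(\<integral>\<^sup>+x. ennreal (\<bar>fhat x\<bar> - c) \<partial>M) \<le> (\<integral>\<^sup>+x. ennreal (\<bar>f x\<bar> - c) \<partial>M)" if c: "0 < c" for c
  proof -
    have "AE x in M. ennreal (\<bar>fhat x\<bar> - c) = liminf (\<lambda>n. ennreal (\<bar>?A n x\<bar> - c))"
      using conv
    proof eventually_elim
      case (elim x)
      then have "(\<lambda>n. ennreal (\<bar>?A n x\<bar> - c)) \<longlonglongrightarrow> ennreal (\<bar>fhat x\<bar> - c)"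
        by (intro tendsto_ennrealI tendsto_intros)
      then show ?case
        by (intro lim_imp_Liminf[symmetric]) simp
    qed
    then have "(\<integral>\<^sup>+x. ennreal (\<bar>fhat x\<bar> - c) \<partial>M) = (\<integral>\<^sup>+x. liminf (\<lambda>n. ennreal (\<bar>?A n x\<bar> - c)) \<partial>M)"
      by (rule nn_integral_cong_AE)
    also have "\<dots> \<le> liminf (\<lambda>n. \<integral>\<^sup>+x. ennreal (\<bar>?A n x\<bar> - c) \<partial>M)"
      by (rule nn_integral_liminf) measurable
    also have "\<dots> \<le> liminf (\<lambda>n. \<integral>\<^sup>+x. ennreal (\<bar>f x\<bar> - c) \<partial>M)"
      using c by (intro Liminf_mono always_eventually allI ds_excess_le[OF ds_ergodic_average[OF T] f_X]) simp
    also have "\<dots> = (\<integral>\<^sup>+x. ennreal (\<bar>f x\<bar> - c) \<partial>M)"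
      by (simp add: Liminf_const)
    finally show ?thesis .
  qed
  have fhat_X: "fhat \<in> L1_plus_Linf M"
    using le_less_trans[OF excess R_space_excess_finite[OF fR], of 1]
    by (auto simp: L1_plus_Linf_iff intro!: exI[of _ 1])
  have "fhat \<in> E"
    by (rule symm[OF f fhat_X submajorized_if_excess_le[OF M f_X fhat_X excess]])
  then show "\<exists>fhat\<in>E. AE x in M. (\<lambda>n. ergodic_average T n f x) \<longlonglongrightarrow> fhat x"
    using conv by blast
qed

lemma rearrangement_one:
  assumes inf: "emeasure M (space M) = \<infinity>" and t: "0 < t"
  shows "rearrangement M (indicator (space M)) t = 1"
proof (rule antisym)
  let ?one = "indicator (space M) :: 'a \<Rightarrow> real"
  have one: "?one \<in> L1_plus_Linf M"
    by (rule bounded_in_L1_plus_Linf[where c = 1]) auto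
  show "rearrangement M ?one t \<le> 1"
    by (rule rearrangement_le_bound[OF _ _ _ t]) auto
  show "1 \<le> rearrangement M ?one t"
  proof (rule dense_le)
    fix l :: real assume l: "l < 1"
    have "max 0 l < rearrangement M ?one t"
    proof (subst less_rearrangement_iff[OF one t])
      have "{x \<in> space M. max 0 l < \<bar>?one x\<bar>} = space M"
        using l by auto
      then show "ennreal t < emeasure M {x \<in> space M. max 0 l < \<bar>?one x\<bar>}"
        by (simp add: inf)
    qed simp
    then show "l \<le> rearrangement M ?one t" by simp
  qed
qed

text \<open>A rearrangement is non-increasing, so if it does not vanish at infinity it is bounded below by
  some \<open>e > 0\<close>; then the constant \<open>e\<close> is submajorized by the function.\<close>

lemma one_in_if_not_R_space:
  assumes sub: "E \<subseteq> L1_plus_Linf M" and f: "f \<in> E" and nR: "f \<notin> R_space M"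
    and scale: "\<And>f c. f \<in> E \<Longrightarrow> (\<lambda>x. c * f x) \<in> E"
    and symm: "\<And>f g. f \<in> E \<Longrightarrow> g \<in> L1_plus_Linf M \<Longrightarrow> submajorized M g f \<Longrightarrow> g \<in> E"
  shows "(indicator (space M) :: 'a \<Rightarrow> real) \<in> E"
proof -
  have f_X: "f \<in> L1_plus_Linf M" using f sub by blast
  then have "\<not> (rearrangement M f \<longlongrightarrow> 0) at_top"
    using nR by (simp add: R_space_def)
  have "\<exists>e>0. \<forall>t>0. e \<le> rearrangement M f t"
  proof (rule ccontr)
    assume contra: "\<not> ?thesis"
    have "(rearrangement M f \<longlongrightarrow> 0) at_top"
    proof (rule tendstoI)
      fix e :: real assume "0 < e"
      then obtain s where s: "0 < s" "rearrangement M f s < e"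
        using contra by (force simp: not_le)
      show "\<forall>\<^sub>F t in at_top. dist (rearrangement M f t) 0 < e"
        using eventually_ge_at_top[of s]
      proof eventually_elim
        case (elim t)
        then show ?case
          using s rearrangement_antimono[OF f_X s(1) elim] rearrangement_nonneg[OF f_X, of t]
          by (simp add: dist_real_def)
      qed
    qed
    with \<open>\<not> (rearrangement M f \<longlongrightarrow> 0) at_top\<close> show False by blast
  qed
  then obtain e where e: "0 < e" "\<And>t. 0 < t \<Longrightarrow> e \<le> rearrangement M f t" by blast
  let ?g = "\<lambda>x. e * indicator (space M) x :: real"
  have le: "AE x in M. \<bar>?g x\<bar> \<le> e"
    using e by (auto simp: indicator_def)
  have "submajorized M ?g f"
  proof (rule submajorized_if_rearrangement_le)
    fix t :: real assume t: "0 < t"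
    have "rearrangement M ?g t \<le> e"
      by (rule rearrangement_le_bound[OF _ _ le t]) (use e in auto)
    also have "\<dots> \<le> rearrangement M f t" by (rule e(2)[OF t])
    finally show "rearrangement M ?g t \<le> rearrangement M f t" .
  qed
  moreover have "?g \<in> L1_plus_Linf M"
    by (rule bounded_in_L1_plus_Linf[OF _ le]) auto
  ultimately have "?g \<in> E"
    by (intro symm[OF f])
  then have "(\<lambda>x. (1 / e) * ?g x) \<in> E"
    by (rule scale)
  then show ?thesis using e by simp
qed

section \<open>Divergent averages of a bounded function\<close>

text \<open>The blocks are differences of increasing sets whose measure more than doubles at each step.\<close>

lemma disjoint_sets_nondecreasing_measure:
  assumes M: "sigma_finite_measure M" and inf: "emeasure M (space M) = \<infinity>"
  obtains A :: "nat \<Rightarrow> 'a set" where "range A \<subseteq> sets M" "disjoint_family A"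
    "\<And>n. emeasure M (A n) < \<infinity>" "\<And>n. 0 < measure M (A n)"
    "\<And>n. measure M (A n) \<le> measure M (A (Suc n))"
proof -
  interpret sigma_finite_measure M by fact
  obtain S :: "nat \<Rightarrow> 'a set" where S: "range S \<subseteq> sets M" "(\<Union>i. S i) = space M"
    "\<And>i. emeasure M (S i) \<noteq> \<infinity>" "incseq S"
    using sigma_finite_incseq by blast
  have large: "\<exists>i. K \<le> measure M (S i)" for K
  proof -
    have "(SUP i. emeasure M (S i)) = \<infinity>"
      unfolding SUP_emeasure_incseq[OF S(1,4)] S(2) by (rule inf)
    then have "ennreal K < (SUP i. emeasure M (S i))"
      by (simp only: infinity_ennreal_def ennreal_less_top)
    then obtain i where "ennreal K < emeasure M (S i)" by (auto simp: less_SUP_iff)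
    then have "ennreal K < ennreal (measure M (S i))"
      using S(3)[of i] by (simp add: emeasure_eq_ennreal_measure)
    then have "K \<le> measure M (S i)"
      by (metis ennreal_leI leI less_imp_le not_less)
    then show ?thesis ..
  qed
  have "\<exists>R. \<forall>n. (R n \<in> sets M \<and> emeasure M (R n) < \<infinity>) \<and>
      (R n \<subseteq> R (Suc n) \<and> 2 * measure M (R n) + 1 \<le> measure M (R (Suc n)))"
  proof (rule dependent_nat_choice)
    show "\<exists>R. R \<in> sets M \<and> emeasure M R < \<infinity>"
      by (intro exI[of _ "{}"]) simp
    fix R assume R: "R \<in> sets M \<and> emeasure M R < \<infinity>"
    obtain i where i: "2 * measure M R + 1 \<le> measure M (S i)"
      using large by blast
    have fin: "emeasure M (R \<union> S i) < \<infinity>"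
      using R S(1) S(3)[of i] by (intro le_less_trans[OF emeasure_subadditive]) (auto simp: less_top)
    have "measure M (S i) \<le> measure M (R \<union> S i)"
      using R S(1) fin by (intro measure_mono_fmeasurable) (auto simp: fmeasurable_def)
    then show "\<exists>R'. (R' \<in> sets M \<and> emeasure M R' < \<infinity>) \<and> (R \<subseteq> R' \<and> 2 * measure M R + 1 \<le> measure M R')"
      using R S(1) fin i by (intro exI[of _ "R \<union> S i"]) auto
  qed
  then obtain R where R: "\<And>n. R n \<in> sets M" "\<And>n. emeasure M (R n) < \<infinity>"
    "\<And>n. R n \<subseteq> R (Suc n)" "\<And>n. 2 * measure M (R n) + 1 \<le> measure M (R (Suc n))"
    by blast
  have mono: "R i \<subseteq> R j" if "i \<le> j" for i j
    using lift_Suc_mono_le[of R, OF R(3) that] .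
  define A where "A n = R (Suc n) - R n" for n
  have measure_A: "measure M (A n) = measure M (R (Suc n)) - measure M (R n)" for n
    unfolding A_def using R(1-3) by (intro measure_Diff) (auto simp: less_top)
  show thesis
  proof
    show "range A \<subseteq> sets M" using R(1) by (auto simp: A_def)
    have "A i \<inter> A j = {}" if "i < j" for i j
      using mono[of "Suc i" j] that by (auto simp: A_def)
    then show "disjoint_family A"
      unfolding disjoint_family_on_def by (metis inf_commute linorder_neqE_nat)
    show "emeasure M (A n) < \<infinity>" for n
      by (rule le_less_trans[OF emeasure_mono R(2)[of "Suc n"]]) (use R(1) in \<open>auto simp: A_def\<close>)
    show "0 < measure M (A n)" for n
      using R(4)[of n] measure_nonneg[of M "R n"] unfolding measure_A by linarith
    show "measure M (A n) \<le> measure M (A (Suc n))" for n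
      using R(4)[of n] R(4)[of "Suc n"] measure_nonneg[of M "R n"] unfolding measure_A by linarith
  qed
qed

text \<open>The value \<open>s i\<close> on the \<open>i\<close>-th block; for disjoint blocks the least index is the only one.\<close>

definition step_function :: "(nat \<Rightarrow> 'a set) \<Rightarrow> (nat \<Rightarrow> real) \<Rightarrow> 'a \<Rightarrow> real" where
  "step_function A s x = (if x \<in> (\<Union>i. A i) then s (LEAST i. x \<in> A i) else 0)"

definition set_mean :: "'a measure \<Rightarrow> 'a set \<Rightarrow> ('a \<Rightarrow> real) \<Rightarrow> real" where
  "set_mean M A f = (\<integral>x. indicator A x * f x \<partial>M) / measure M A"

definition shift_of_means :: "'a measure \<Rightarrow> (nat \<Rightarrow> 'a set) \<Rightarrow> ('a \<Rightarrow> real) \<Rightarrow> 'a \<Rightarrow> real" where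
  "shift_of_means M A f = step_function A (\<lambda>i. set_mean M (A (Suc i)) f)"

lemma step_function_on:
  assumes "disjoint_family A" "x \<in> A i"
  shows "step_function A s x = s i"
proof -
  have unique: "j = i" if "x \<in> A j" for j
    using assms that unfolding disjoint_family_on_def by blast
  have "(LEAST i. x \<in> A i) = i"
    by (rule Least_equality, fact) (drule unique, simp)
  then show ?thesis using assms(2) by (auto simp: step_function_def)
qed

lemma step_function_off: "x \<notin> (\<Union>i. A i) \<Longrightarrow> step_function A s x = 0"
  unfolding step_function_def by (rule if_not_P)

lemma step_function_measurable:
  assumes "range A \<subseteq> sets M"
  shows "step_function A s \<in> borel_measurable M"
proof -
  have [measurable]: "A i \<in> sets M" for i using assms by auto
  show ?thesis unfolding step_function_def[abs_def] by measurable
qed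

lemma integrable_on_finite_measure:
  assumes f: "f \<in> L1_plus_Linf M" and A: "A \<in> sets M" "emeasure M A < \<infinity>"
  shows "integrable M (\<lambda>x. indicator A x * f x)"
proof -
  obtain c where [measurable]: "f \<in> borel_measurable M"
    and c: "0 \<le> c" "(\<integral>\<^sup>+x. ennreal (\<bar>f x\<bar> - c) \<partial>M) < \<infinity>"
    using f by (auto simp: L1_plus_Linf_iff)
  note [measurable] = A(1)
  have "(\<integral>\<^sup>+x. ennreal (norm (indicator A x * f x)) \<partial>M)
      \<le> (\<integral>\<^sup>+x. ennreal (\<bar>f x\<bar> - c) + ennreal c * indicator A x \<partial>M)"
  proof (rule nn_integral_mono)
    fix x
    have "ennreal \<bar>f x\<bar> \<le> ennreal (max 0 (\<bar>f x\<bar> - c) + c)"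
      by (intro ennreal_leI) auto
    also have "\<dots> = ennreal (\<bar>f x\<bar> - c) + ennreal c"
      using c by (subst ennreal_plus) (auto simp: max_def ennreal_neg)
    finally show "ennreal (norm (indicator A x * f x)) \<le> ennreal (\<bar>f x\<bar> - c) + ennreal c * indicator A x"
      by (cases "x \<in> A") simp_all
  qed
  also have "\<dots> = (\<integral>\<^sup>+x. ennreal (\<bar>f x\<bar> - c) \<partial>M) + ennreal c * emeasure M A"
    by (subst nn_integral_add) (auto simp: nn_integral_cmult_indicator)
  also have "\<dots> < \<infinity>"
    using c A by (simp add: ennreal_mult_less_top)
  finally show ?thesis
    by (simp add: integrable_iff_bounded)
qed

text \<open>Jensen's inequality for the convex function \<open>a \<mapsto> (\<bar>a\<bar> - c)\<^sup>+\<close>.\<close>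

lemma set_mean_excess:
  assumes f: "f \<in> L1_plus_Linf M" and A: "A \<in> sets M" "emeasure M A < \<infinity>" "0 < measure M A"
    and c: "0 \<le> c"
  shows "ennreal (\<bar>set_mean M A f\<bar> - c) * emeasure M A \<le> (\<integral>\<^sup>+x. ennreal (\<bar>f x\<bar> - c) * indicator A x \<partial>M)"
proof -
  have [measurable]: "f \<in> borel_measurable M" by (rule L1_plus_Linf_measurable[OF f])
  note [measurable] = A(1)
  have int_f: "integrable M (\<lambda>x. indicator A x * f x)"
    by (rule integrable_on_finite_measure[OF f A(1,2)])
  then have int_abs: "integrable M (\<lambda>x. indicator A x * \<bar>f x\<bar>)"
    by (rule Bochner_Integration.integrable_bound) (auto simp: abs_mult)
  have int_c: "integrable M (\<lambda>x. c * indicator A x :: real)"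
    using A by (intro integrable_mult_right) simp
  have int_max: "integrable M (\<lambda>x. indicator A x * max 0 (\<bar>f x\<bar> - c))"
    by (rule Bochner_Integration.integrable_bound[OF int_f]) (use c in \<open>auto simp: indicator_def\<close>)
  have "\<bar>set_mean M A f\<bar> * measure M A = \<bar>\<integral>x. indicator A x * f x \<partial>M\<bar>"
    using A(3) by (simp add: set_mean_def)
  also have "\<dots> \<le> (\<integral>x. \<bar>indicator A x * f x\<bar> \<partial>M)"
    by (rule integral_abs_bound)
  also have "\<dots> = (\<integral>x. indicator A x * \<bar>f x\<bar> \<partial>M)"
    by (simp add: abs_mult)
  finally have "(\<bar>set_mean M A f\<bar> - c) * measure M A
      \<le> (\<integral>x. indicator A x * \<bar>f x\<bar> \<partial>M) - (\<integral>x. c * indicator A x \<partial>M)"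
    using A by (simp add: left_diff_distrib)
  also have "\<dots> = (\<integral>x. indicator A x * \<bar>f x\<bar> - c * indicator A x \<partial>M)"
    by (rule Bochner_Integration.integral_diff[symmetric, OF int_abs int_c])
  also have "\<dots> \<le> (\<integral>x. indicator A x * max 0 (\<bar>f x\<bar> - c) \<partial>M)"
    by (intro integral_mono Bochner_Integration.integrable_diff int_abs int_c int_max)
       (auto simp: indicator_def)
  finally have "ennreal ((\<bar>set_mean M A f\<bar> - c) * measure M A)
      \<le> ennreal (\<integral>x. indicator A x * max 0 (\<bar>f x\<bar> - c) \<partial>M)"
    by (rule ennreal_leI)
  also have "\<dots> = (\<integral>\<^sup>+x. ennreal (indicator A x * max 0 (\<bar>f x\<bar> - c)) \<partial>M)"
    by (rule nn_integral_eq_integral[symmetric, OF int_max]) auto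
  also have "\<dots> = (\<integral>\<^sup>+x. ennreal (\<bar>f x\<bar> - c) * indicator A x \<partial>M)"
    by (intro nn_integral_cong) (auto simp: indicator_def max_def ennreal_neg)
  finally show ?thesis
    using A by (simp add: ennreal_mult'' emeasure_eq_ennreal_measure less_top)
qed

lemma shift_of_means_excess:
  assumes A: "range A \<subseteq> sets M" "disjoint_family A" "\<And>n. emeasure M (A n) < \<infinity>"
    "\<And>n. 0 < measure M (A n)" "\<And>n. measure M (A n) \<le> measure M (A (Suc n))"
    and f: "f \<in> L1_plus_Linf M" and c: "0 \<le> c"
  shows "(\<integral>\<^sup>+x. ennreal (\<bar>shift_of_means M A f x\<bar> - c) \<partial>M) \<le> (\<integral>\<^sup>+x. ennreal (\<bar>f x\<bar> - c) \<partial>M)"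
proof -
  have [measurable]: "f \<in> borel_measurable M" by (rule L1_plus_Linf_measurable[OF f])
  have sets [measurable]: "A i \<in> sets M" for i using A(1) by auto
  let ?m = "\<lambda>i. set_mean M (A (Suc i)) f"
  have disj: "disjoint_family (\<lambda>i. A (Suc i))"
    using A(2) by (auto simp: disjoint_family_on_def)
  have pointwise: "ennreal (\<bar>shift_of_means M A f x\<bar> - c) = (\<Sum>i. ennreal (\<bar>?m i\<bar> - c) * indicator (A i) x)"
    for x
  proof (cases "x \<in> (\<Union>i. A i)")
    case True
    then obtain i where i: "x \<in> A i" by blast
    have "(\<Sum>i. ennreal (\<bar>?m i\<bar> - c) * indicator (A i) x) = ennreal (\<bar>?m i\<bar> - c)"
      by (rule suminf_cmult_indicator[OF A(2) i])
    then show ?thesis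
      by (simp add: shift_of_means_def step_function_on[OF A(2) i])
  next
    case False
    then show ?thesis
      using c by (simp add: shift_of_means_def step_function_off ennreal_neg)
  qed
  have "(\<integral>\<^sup>+x. ennreal (\<bar>shift_of_means M A f x\<bar> - c) \<partial>M) = (\<Sum>i. ennreal (\<bar>?m i\<bar> - c) * emeasure M (A i))"
    unfolding pointwise by (subst nn_integral_suminf) (simp_all add: nn_integral_cmult_indicator)
  also have "\<dots> \<le> (\<Sum>i. \<integral>\<^sup>+x. ennreal (\<bar>f x\<bar> - c) * indicator (A (Suc i)) x \<partial>M)"
  proof (intro suminf_le summableI)
    fix i
    have "emeasure M (A i) \<le> emeasure M (A (Suc i))"
      using A(3,5) by (simp add: emeasure_eq_ennreal_measure less_top ennreal_leI)
    then have "ennreal (\<bar>?m i\<bar> - c) * emeasure M (A i) \<le> ennreal (\<bar>?m i\<bar> - c) * emeasure M (A (Suc i))"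
      by (intro mult_left_mono) simp_all
    also have "\<dots> \<le> (\<integral>\<^sup>+x. ennreal (\<bar>f x\<bar> - c) * indicator (A (Suc i)) x \<partial>M)"
      by (rule set_mean_excess[OF f sets A(3,4) c])
    finally show "ennreal (\<bar>?m i\<bar> - c) * emeasure M (A i)
        \<le> (\<integral>\<^sup>+x. ennreal (\<bar>f x\<bar> - c) * indicator (A (Suc i)) x \<partial>M)" .
  qed
  also have "\<dots> = (\<integral>\<^sup>+x. (\<Sum>i. ennreal (\<bar>f x\<bar> - c) * indicator (A (Suc i)) x) \<partial>M)"
    by (rule nn_integral_suminf[symmetric]) measurable
  also have "\<dots> \<le> (\<integral>\<^sup>+x. ennreal (\<bar>f x\<bar> - c) \<partial>M)"
  proof (rule nn_integral_mono)
    fix x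
    show "(\<Sum>i. ennreal (\<bar>f x\<bar> - c) * indicator (A (Suc i)) x) \<le> ennreal (\<bar>f x\<bar> - c)"
    proof (cases "\<exists>i. x \<in> A (Suc i)")
      case True
      then obtain i where "x \<in> A (Suc i)" by blast
      then show ?thesis
        using suminf_cmult_indicator[OF disj, of x i "\<lambda>_. ennreal (\<bar>f x\<bar> - c)"] by simp
    next
      case False
      then show ?thesis by simp
    qed
  qed
  finally show ?thesis .
qed

text \<open>The operator moves the mean over each block to the block before it. Moving mass to a block of
  smaller measure keeps the values and so cannot increase the \<open>L\<^sup>1\<close> norm.\<close>

lemma dunford_schwartz_shift_of_means:
  assumes A: "range A \<subseteq> sets M" "disjoint_family A" "\<And>n. emeasure M (A n) < \<infinity>"
    "\<And>n. 0 < measure M (A n)" "\<And>n. measure M (A n) \<le> measure M (A (Suc n))"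
  shows "dunford_schwartz M (shift_of_means M A)"
proof (rule dunford_schwartzI)
  note excess = shift_of_means_excess[OF A]
  have meas [measurable]: "shift_of_means M A f \<in> borel_measurable M" for f
    unfolding shift_of_means_def by (rule step_function_measurable[OF A(1)])
  have sets [measurable]: "A i \<in> sets M" for i using A(1) by auto
  have step: "step_function A s x = step_function A s' x" if "\<And>i. s i = s' i" for s s' x
    using that by (simp add: step_function_def)
  show "shift_of_means M A f \<in> L1_plus_Linf M" if f: "f \<in> L1_plus_Linf M" for f
  proof -
    obtain c where "0 \<le> c" "(\<integral>\<^sup>+x. ennreal (\<bar>f x\<bar> - c) \<partial>M) < \<infinity>"
      using f by (auto simp: L1_plus_Linf_iff)
    then show ?thesis
      using le_less_trans[OF excess[OF f]] meas by (auto simp: L1_plus_Linf_iff)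
  qed
  show "AE x in M. shift_of_means M A f x = shift_of_means M A g x"
    if f: "f \<in> L1_plus_Linf M" and g: "g \<in> L1_plus_Linf M" and eq: "AE x in M. f x = g x" for f g
  proof -
    have [measurable]: "f \<in> borel_measurable M" "g \<in> borel_measurable M"
      using f g by (auto intro: L1_plus_Linf_measurable)
    have "(\<integral>x. indicator (A i) x * f x \<partial>M) = (\<integral>x. indicator (A i) x * g x \<partial>M)" for i
      by (rule integral_cong_AE, measurable) (use eq in \<open>eventually_elim, simp\<close>)
    then have "set_mean M (A i) f = set_mean M (A i) g" for i
      by (simp add: set_mean_def)
    then show ?thesis
      by (simp add: shift_of_means_def)
  qed
  show "AE x in M. shift_of_means M A (\<lambda>y. f y + g y) x = shift_of_means M A f x + shift_of_means M A g x"
    if f: "f \<in> L1_plus_Linf M" and g: "g \<in> L1_plus_Linf M" for f g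
  proof -
    have "(\<integral>x. indicator (A i) x * (f x + g x) \<partial>M)
        = (\<integral>x. indicator (A i) x * f x \<partial>M) + (\<integral>x. indicator (A i) x * g x \<partial>M)" for i
      unfolding distrib_left
      by (intro Bochner_Integration.integral_add integrable_on_finite_measure f g sets A(3))
    then have "set_mean M (A i) (\<lambda>y. f y + g y) = set_mean M (A i) f + set_mean M (A i) g" for i
      by (simp add: set_mean_def add_divide_distrib)
    then show ?thesis
      by (simp add: shift_of_means_def step_function_def)
  qed
  show "AE x in M. shift_of_means M A (\<lambda>y. c * f y) x = c * shift_of_means M A f x" for c f
  proof -
    have "set_mean M (A i) (\<lambda>y. c * f y) = c * set_mean M (A i) f" for i
      by (simp add: set_mean_def mult.left_commute)
    then show ?thesis
      by (simp add: shift_of_means_def step_function_def)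
  qed
  show "(\<integral>\<^sup>+x. ennreal \<bar>shift_of_means M A f x\<bar> \<partial>M) \<le> (\<integral>\<^sup>+x. ennreal \<bar>f x\<bar> \<partial>M)" if "f \<in> L1 M" for f
    using excess[OF L1_subset[OF that], of 0] by simp
  show "AE x in M. \<bar>shift_of_means M A f x\<bar> \<le> c"
    if f: "f \<in> borel_measurable M" and c: "0 \<le> c" "AE x in M. \<bar>f x\<bar> \<le> c" for f c
  proof -
    have "(\<integral>\<^sup>+x. ennreal (\<bar>f x\<bar> - c) \<partial>M) = (\<integral>\<^sup>+x. 0 \<partial>M)"
      by (rule nn_integral_cong_AE) (use c(2) in \<open>eventually_elim, simp add: ennreal_neg\<close>)
    then have "(\<integral>\<^sup>+x. ennreal (\<bar>shift_of_means M A f x\<bar> - c) \<partial>M) = 0"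
      using excess[OF bounded_in_L1_plus_Linf[OF f c(2)] c(1)] by simp
    then have "AE x in M. ennreal (\<bar>shift_of_means M A f x\<bar> - c) = 0"
      by (subst (asm) nn_integral_0_iff_AE) auto
    then show ?thesis
      by eventually_elim (simp add: ennreal_eq_0_iff)
  qed
qed

text \<open>The value 1 on \<open>[4\<^sup>j, 2 \<cdot> 4\<^sup>j)\<close> and 0 on \<open>[2 \<cdot> 4\<^sup>j, 4\<^bsup>j+1\<^esup>)\<close>: with \<open>c\<^sub>n\<close> the Cesaro means,
  \<open>2 c\<^bsub>2n\<^esub> - c\<^sub>n\<close> is the mean over \<open>[n, 2n)\<close>, which takes both values infinitely often.\<close>

definition dyadic_blocks :: "nat \<Rightarrow> real" where
  "dyadic_blocks k = of_bool (\<exists>j. 4 ^ j \<le> k \<and> k < 2 * 4 ^ j)"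

lemma Cesaro_means_dyadic_blocks_divergent:
  "\<not> (\<lambda>n. (1 / real n) * (\<Sum>k<n. dyadic_blocks k)) \<longlonglongrightarrow> L"
proof
  let ?c = "\<lambda>n. (1 / real n) * (\<Sum>k<n. dyadic_blocks k)"
  assume lim: "?c \<longlonglongrightarrow> L"
  have block: "2 * ?c (2 * n) - ?c n = b" if n: "0 < n" and b: "\<And>k. n \<le> k \<Longrightarrow> k < 2 * n \<Longrightarrow> dyadic_blocks k = b"
    for n b
  proof -
    have "(\<Sum>k<2 * n. dyadic_blocks k) = (\<Sum>k<n. dyadic_blocks k) + (\<Sum>k=n..<2 * n. dyadic_blocks k)"
      using sum.atLeastLessThan_concat[of 0 n "2 * n" dyadic_blocks] by (simp add: atLeast0LessThan)
    also have "(\<Sum>k=n..<2 * n. dyadic_blocks k) = (\<Sum>k=n..<2 * n. b)"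
      by (rule sum.cong) (use b in auto)
    finally show ?thesis using n by (simp add: field_simps)
  qed
  have sub: "(\<lambda>j. 2 * ?c (2 * r j) - ?c (r j)) \<longlonglongrightarrow> L" if r: "strict_mono r" for r :: "nat \<Rightarrow> nat"
  proof -
    have "strict_mono (\<lambda>j. 2 * r j)" using r by (simp add: strict_mono_def)
    then have "(\<lambda>j. 2 * ?c (2 * r j) - ?c (r j)) \<longlonglongrightarrow> 2 * L - L"
      using LIMSEQ_subseq_LIMSEQ[OF lim, of "\<lambda>j. 2 * r j"] LIMSEQ_subseq_LIMSEQ[OF lim r]
      by (intro tendsto_diff tendsto_mult tendsto_const) (simp_all add: comp_def)
    then show ?thesis by simp
  qed
  have one: "dyadic_blocks k = 1" if "4 ^ j \<le> k" "k < 2 * 4 ^ j" for j k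
    using that by (auto simp: dyadic_blocks_def)
  have zero: "dyadic_blocks k = 0" if k: "2 * 4 ^ j \<le> k" "k < 2 * (2 * 4 ^ j)" for j k
  proof -
    have "\<not> (4 ^ i \<le> k \<and> k < 2 * 4 ^ i)" for i
    proof (cases "i \<le> j")
      case True
      then have "(4::nat) ^ i \<le> 4 ^ j" by (intro power_increasing) auto
      then show ?thesis using k by linarith
    next
      case False
      then have "(4::nat) ^ Suc j \<le> 4 ^ i" by (intro power_increasing) auto
      then show ?thesis using k by auto
    qed
    then show ?thesis by (simp add: dyadic_blocks_def)
  qed
  have "(\<lambda>j. 2 * ?c (2 * 4 ^ j) - ?c (4 ^ j)) \<longlonglongrightarrow> L"
    by (rule sub) (simp add: strict_mono_def power_strict_increasing)
  moreover have "2 * ?c (2 * 4 ^ j) - ?c (4 ^ j) = 1" for j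
    by (rule block) (simp_all add: one)
  ultimately have "L = 1"
    by (simp add: LIMSEQ_const_iff)
  have "(\<lambda>j. 2 * ?c (2 * (2 * 4 ^ j)) - ?c (2 * 4 ^ j)) \<longlonglongrightarrow> L"
    by (rule sub) (simp add: strict_mono_def power_strict_increasing)
  moreover have "2 * ?c (2 * (2 * 4 ^ j)) - ?c (2 * 4 ^ j) = 0" for j
    by (rule block) (simp_all add: zero)
  ultimately have "L = 0"
    by (simp add: LIMSEQ_const_iff)
  with \<open>L = 1\<close> show False by simp
qed

text \<open>On step functions over the blocks the operator is the left shift, so on the first block the
  averages are the Cesaro means of the sequence of values.\<close>

lemma divergent_averages_of_bounded_function:
  assumes M: "sigma_finite_measure M" and inf: "emeasure M (space M) = \<infinity>"
  obtains T f where "dunford_schwartz M T" "f \<in> borel_measurable M" "\<And>x. \<bar>f x\<bar> \<le> 1"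
    "\<not> (AE x in M. convergent (\<lambda>n. ergodic_average T n f x))"
proof -
  obtain A :: "nat \<Rightarrow> 'a set" where A: "range A \<subseteq> sets M" "disjoint_family A"
    "\<And>n. emeasure M (A n) < \<infinity>" "\<And>n. 0 < measure M (A n)"
    "\<And>n. measure M (A n) \<le> measure M (A (Suc n))"
    by (rule disjoint_sets_nondecreasing_measure[OF M inf]) blast
  have sets: "A i \<in> sets M" for i using A(1) by auto
  let ?T = "shift_of_means M A" and ?f = "step_function A dyadic_blocks"
  have mean: "set_mean M (A i) (step_function A s) = s i" for i s
  proof -
    have "(\<integral>x. indicator (A i) x * step_function A s x \<partial>M) = (\<integral>x. s i * indicator (A i) x \<partial>M)"
      by (rule Bochner_Integration.integral_cong)
         (auto simp: indicator_def step_function_on[OF A(2)])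
    also have "\<dots> = s i * measure M (A i)"
      using sets[of i] by simp
    finally show ?thesis
      using A(4)[of i] by (simp add: set_mean_def)
  qed
  have orbit: "(?T ^^ k) (step_function A s) = step_function A (\<lambda>i. s (i + k))" for k s
    by (induction k) (simp_all add: shift_of_means_def mean)
  show thesis
  proof
    show "dunford_schwartz M ?T" by (rule dunford_schwartz_shift_of_means[OF A])
    show "?f \<in> borel_measurable M" by (rule step_function_measurable[OF A(1)])
    show "\<bar>?f x\<bar> \<le> 1" for x
      by (simp add: step_function_def dyadic_blocks_def)
    show "\<not> (AE x in M. convergent (\<lambda>n. ergodic_average ?T n ?f x))"
    proof
      assume "AE x in M. convergent (\<lambda>n. ergodic_average ?T n ?f x)"
      moreover have "\<not> convergent (\<lambda>n. ergodic_average ?T n ?f x)" if "x \<in> A 0" for x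
        using Cesaro_means_dyadic_blocks_divergent
        by (simp add: convergent_def ergodic_average_def orbit step_function_on[OF A(2) that])
      ultimately have "AE x in M. x \<notin> A 0"
        by (auto elim!: eventually_mono)
      then have "emeasure M (A 0) = 0"
        using sets[of 0] by (simp add: AE_iff_measurable[OF sets[of 0]] sets.sets_into_space Int_absorb1
            AE_iff_null_sets null_setsD1)
      then show False
        using A(4)[of 0] by (simp add: measure_def)
    qed
  qed
qed

theorem theorem4p1:
  fixes M :: "'a measure"
    and E :: "('a \<Rightarrow> real) set"
    and N :: "('a \<Rightarrow> real) \<Rightarrow> real"
  assumes "complete_measure M"
    and "sigma_finite_measure M"
    and "emeasure M (space M) = \<infinity>"
    and "quasi_non_atomic M"
    and "fully_symmetric_space M E N"
  shows "(individual_ergodic_property M E \<longleftrightarrow> E \<subseteq> R_space M) \<and>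
         (E \<subseteq> R_space M \<longleftrightarrow> (indicator (space M) :: 'a \<Rightarrow> real) \<notin> E)"
proof -
  note M = assms(2) and inf = assms(3)
  note fully_symmetric = assms(5)[unfolded fully_symmetric_space_def]
  have space: "ae_subspace M E"
    by (rule conjunct1[OF fully_symmetric])
  have symmetric: "\<forall>f \<in> E. \<forall>g \<in> L1_plus_Linf M. submajorized M g f \<longrightarrow> g \<in> E \<and> N g \<le> N f"
    by (rule conjunct2[OF conjunct2[OF conjunct2[OF fully_symmetric]]])
  have sub: "E \<subseteq> L1_plus_Linf M"
    using space unfolding ae_subspace_def by blast
  have scale: "(\<lambda>x. c * f x) \<in> E" if "f \<in> E" for f c
    using space that unfolding ae_subspace_def by blast
  have symm: "g \<in> E" if "f \<in> E" "g \<in> L1_plus_Linf M" "submajorized M g f" for f g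
    using symmetric that by blast
  have ergodic: "individual_ergodic_property M E" if "E \<subseteq> R_space M"
    by (rule individual_ergodic_property_if_R_space[OF M that]) (rule symm)
  have no_one: "(indicator (space M) :: 'a \<Rightarrow> real) \<notin> E" if iet: "individual_ergodic_property M E"
  proof
    assume one: "(indicator (space M) :: 'a \<Rightarrow> real) \<in> E"
    obtain T f where T: "dunford_schwartz M T" and f: "f \<in> borel_measurable M" "\<And>x. \<bar>f x\<bar> \<le> 1"
      and div: "\<not> (AE x in M. convergent (\<lambda>n. ergodic_average T n f x))"
      by (rule divergent_averages_of_bounded_function[OF M inf]) blast
    have bound: "AE x in M. \<bar>f x\<bar> \<le> 1" using f(2) by simp
    have "submajorized M f (indicator (space M))"
      by (rule submajorized_if_rearrangement_le)
         (simp add: rearrangement_one[OF inf] rearrangement_le_bound[OF f(1) _ bound])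
    then have "f \<in> E"
      by (rule symm[OF one bounded_in_L1_plus_Linf[OF f(1) bound]])
    then obtain fhat where "AE x in M. (\<lambda>n. ergodic_average T n f x) \<longlonglongrightarrow> fhat x"
      using iet T unfolding individual_ergodic_property_def by blast
    then have "AE x in M. convergent (\<lambda>n. ergodic_average T n f x)"
      by eventually_elim (rule convergentI)
    with div show False by blast
  qed
  have R: "E \<subseteq> R_space M" if "(indicator (space M) :: 'a \<Rightarrow> real) \<notin> E"
  proof (rule subsetI, rule ccontr)
    fix f assume f: "f \<in> E" "f \<notin> R_space M"
    have "(indicator (space M) :: 'a \<Rightarrow> real) \<in> E"
      by (rule one_in_if_not_R_space[OF sub f]) (rule scale, assumption, rule symm)
    with that show False by blast
  qed
  show ?thesis
    using ergodic no_one R by blast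
qed

end
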